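(* Let $G=(V,E,c)$ be a quasi-bipartite $k$-terminal network and let $0<\varepsilon<\tfrac18$. Then $G$ admits a flow sparsifier $\widehat G$ of quality $1+\varepsilon$ that has at most $\tilde O(k^7/\varepsilon^3)$ vertices.
   Context: A $k$-terminal network $G=(V,E,c)$ is a finite connected undirected graph with nonnegative edge capacities $c_e$ and a set $T\subseteq V$ of $|T|=k$ terminals. It is quasi-bipartite if the non-terminals $V\setminus T$ form an independent set. A demand vector is $\mathbf d\in\mathbb R_+^{\binom T2}$ (a value $d_{st}\ge0$ for each unordered pair of distinct terminals); it can be routed in $G$ if there is a multicommodity flow that simultaneously sends $d_{st}$ units between $s$ and $t$ for all pairs, with total flow on each edge $e$ at most $c_e$. For nonzero $\mathbf d$, $\lambda_G(\mathbf d)=\sup\{\lambda\ge0:\lambda\mathbf d \text{ can be routed in } G\}$. A network $G'=(V',E',c')$ with $T\subseteq V'$ is a flow sparsifier of $G$ with quality $q\ge1$ if $\lambda_G(\mathbf d)\le\lambda_{G'}(\mathbf d)\le q\,\lambda_G(\mathbf d)$ for every nonzero $\mathbf d\in\mathbb R_+^{\binom T2}$. $\tilde O$ hides polylogarithmic factors. *)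

theory Defs
  imports Complex_Main "HOL-Library.Ramsey"
begin

text \<open>Throughout, \<open>nsets A 2\<close> (from Ramsey theory) is the set of two-element subsets of \<open>A\<close>.
  It serves both for undirected edges and for unordered pairs of distinct terminals.\<close>

record 'v network =
  verts :: "'v set"
  edges :: "'v set set"
  cap   :: "'v set \<Rightarrow> real"

text \<open>A terminal set is nonempty, so a network with terminals has at least one vertex.\<close>

definition terminal_network :: "'v network \<Rightarrow> 'v set \<Rightarrow> bool" where
  "terminal_network G T \<longleftrightarrow>
     finite (verts G) \<and>
     edges G \<subseteq> nsets (verts G) 2 \<and>
     (\<forall>u\<in>verts G. \<forall>v\<in>verts G. (u, v) \<in> {(x, y). {x, y} \<in> edges G}\<^sup>*) \<and>
     (\<forall>e\<in>edges G. 0 \<le> cap G e) \<and>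
     T \<subseteq> verts G \<and> T \<noteq> {}"

definition quasi_bipartite :: "'v network \<Rightarrow> 'v set \<Rightarrow> bool" where
  "quasi_bipartite G T \<longleftrightarrow>
     (\<forall>u\<in>verts G - T. \<forall>v\<in>verts G - T. {u, v} \<notin> edges G)"

text \<open>A flow assigns to \<open>u\<close>, \<open>v\<close> the amount \<open>g u v\<close> sent across the edge \<open>{u, v}\<close> in the
  direction from \<open>u\<close> to \<open>v\<close>.\<close>

definition st_flow :: "'v network \<Rightarrow> 'v \<Rightarrow> 'v \<Rightarrow> real \<Rightarrow> ('v \<Rightarrow> 'v \<Rightarrow> real) \<Rightarrow> bool" where
  "st_flow G s t x g \<longleftrightarrow>
     (\<forall>u v. 0 \<le> g u v) \<and>
     (\<forall>u v. {u, v} \<notin> edges G \<longrightarrow> g u v = 0) \<and>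
     (\<forall>v\<in>verts G - {s, t}. (\<Sum>u\<in>verts G. g v u) = (\<Sum>u\<in>verts G. g u v)) \<and>
     (\<Sum>u\<in>verts G. g s u) - (\<Sum>u\<in>verts G. g u s) = x"

text \<open>A demand vector is a function on unordered pairs; only its values on \<open>nsets T 2\<close> matter.\<close>

definition demand :: "'v set \<Rightarrow> ('v set \<Rightarrow> real) \<Rightarrow> bool" where
  "demand T d \<longleftrightarrow> (\<forall>P\<in>nsets T 2. 0 \<le> d P)"

definition nonzero_demand :: "'v set \<Rightarrow> ('v set \<Rightarrow> real) \<Rightarrow> bool" where
  "nonzero_demand T d \<longleftrightarrow> demand T d \<and> (\<exists>P\<in>nsets T 2. d P \<noteq> 0)"

text \<open>There is one commodity for each unordered pair \<open>P\<close> of terminals. Which endpoint of \<open>P\<close> acts as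
  its source is immaterial, since a flow can be reversed. Flows in opposite directions do not
  cancel: both count towards the load of the edge.\<close>

definition routable :: "'v network \<Rightarrow> 'v set \<Rightarrow> ('v set \<Rightarrow> real) \<Rightarrow> bool" where
  "routable G T d \<longleftrightarrow>
     (\<exists>f :: 'v set \<Rightarrow> 'v \<Rightarrow> 'v \<Rightarrow> real.
        (\<forall>P\<in>nsets T 2. \<exists>s t. P = {s, t} \<and> st_flow G s t (d P) (f P)) \<and>
        (\<forall>u v. {u, v} \<in> edges G \<longrightarrow> (\<Sum>P\<in>nsets T 2. f P u v + f P v u) \<le> cap G {u, v}))"

text \<open>For a nonzero demand the set below is nonempty and bounded, so its supremum in the reals
  is the true one: see \<open>throughput_set_nonempty\<close> and \<open>throughput_set_bdd_above\<close>.\<close>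

definition max_throughput :: "'v network \<Rightarrow> 'v set \<Rightarrow> ('v set \<Rightarrow> real) \<Rightarrow> real" where
  "max_throughput G T d = Sup {l. 0 \<le> l \<and> routable G T (\<lambda>P. l * d P)}"

definition flow_sparsifier :: "real \<Rightarrow> 'v network \<Rightarrow> 'v set \<Rightarrow> 'v network \<Rightarrow> bool" where
  "flow_sparsifier q G T G' \<longleftrightarrow>
     1 \<le> q \<and> terminal_network G' T \<and>
     (\<forall>d. nonzero_demand T d \<longrightarrow>
        max_throughput G T d \<le> max_throughput G' T d \<and>
        max_throughput G' T d \<le> q * max_throughput G T d)"

lemma throughput_set_nonempty:
  assumes "terminal_network G T"
  shows "0 \<in> {l. 0 \<le> l \<and> routable G T (\<lambda>P. l * d P)}"
proof -
  have "\<exists>s t. P = {s, t} \<and> st_flow G s t 0 (\<lambda>_ _. 0)" if "P \<in> nsets T 2" for P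
    using that by (auto simp: nsets_def card_2_iff st_flow_def)
  then have "routable G T (\<lambda>P. 0 * d P)"
    using assms unfolding routable_def terminal_network_def
    by (intro exI[of _ "\<lambda>_ _ _. 0"]) auto
  then show ?thesis by simp
qed

lemma throughput_set_bdd_above:
  assumes G: "terminal_network G T" and d: "nonzero_demand T d"
  shows "bdd_above {l. 0 \<le> l \<and> routable G T (\<lambda>P. l * d P)}"
proof -
  obtain Q where Q: "Q \<in> nsets T 2" "d Q > 0"
    using d unfolding nonzero_demand_def demand_def by force
  define M where "M = (\<Sum>v\<in>verts G. \<Sum>u\<in>verts G. \<bar>cap G {v, u}\<bar>)"
  have finV: "finite (verts G)" and TV: "T \<subseteq> verts G"
    using G by (auto simp: terminal_network_def)
  have finP: "finite (nsets T 2)"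
    using finV TV by (simp add: finite_imp_finite_nsets finite_subset)
  have "l \<le> M / d Q" if l: "0 \<le> l" "routable G T (\<lambda>P. l * d P)" for l
  proof -
    obtain f where f: "\<forall>P\<in>nsets T 2. \<exists>s t. P = {s, t} \<and> st_flow G s t (l * d P) (f P)"
      and c: "\<forall>u v. {u, v} \<in> edges G \<longrightarrow> (\<Sum>P\<in>nsets T 2. f P u v + f P v u) \<le> cap G {u, v}"
      using l(2) unfolding routable_def by blast
    have nn: "0 \<le> f P u v" if "P \<in> nsets T 2" for P u v
      using f that unfolding st_flow_def by blast
    obtain s t where st: "Q = {s, t}" "st_flow G s t (l * d Q) (f Q)"
      using f Q(1) by blast
    have sV: "s \<in> verts G" using Q(1) st(1) TV by (auto simp: nsets_def)
    have edge: "f Q s u \<le> \<bar>cap G {s, u}\<bar>" for u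
    proof (cases "{s, u} \<in> edges G")
      case True
      have "f Q s u + f Q u s \<le> (\<Sum>P\<in>nsets T 2. f P s u + f P u s)"
        by (rule member_le_sum[OF Q(1)]) (use nn finP in auto)
      also have "\<dots> \<le> cap G {s, u}" using c True by blast
      finally show ?thesis using nn[OF Q(1), of u s] by linarith
    next
      case False
      then show ?thesis using st(2) by (simp add: st_flow_def)
    qed
    have "0 \<le> (\<Sum>u\<in>verts G. f Q u s)" using nn[OF Q(1)] by (simp add: sum_nonneg)
    then have "l * d Q \<le> (\<Sum>u\<in>verts G. f Q s u)" using st(2) by (simp add: st_flow_def)
    also have "\<dots> \<le> (\<Sum>u\<in>verts G. \<bar>cap G {s, u}\<bar>)" by (intro sum_mono edge)
    also have "\<dots> \<le> M" unfolding M_def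
      by (rule member_le_sum[OF sV]) (auto simp: finV sum_nonneg)
    finally show ?thesis using Q(2) by (simp add: pos_le_divide_eq)
  qed
  then show ?thesis by (intro bdd_aboveI) blast
qed

end

theory Submission
  imports Defs
begin

text \<open>The star around a non-terminal \<open>v\<close> routes exactly the demands \<open>d\<close> with degrees
  \<open>(\<Sum>t. d {s, t}) \<le> c {v, s}\<close>, a fractional b-matching polytope. In a quasi-bipartite network a
  demand is therefore routable iff it is routable in the complete graph on the terminals whose
  capacities are the direct ones plus a point of the Minkowski sum of these polytopes. It remains to
  replace that sum, up to a factor \<open>1 + \<epsilon>\<close>, by a weighted sum of few of its members; a member of
  weight \<open>w\<close> is a star whose capacities are multiplied by \<open>w\<close>.

  By separation, it suffices to preserve the sum of the support functions. A star with value
  \<open>m v Q\<close> on the single pair \<open>Q\<close> contributes at most the fraction \<open>\<Sum>Q. m v Q / (\<Sum>u. m u Q)\<close> of that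
  sum, in every direction. These sensitivities add up to at most the number of pairs, so importance
  sampling with a union bound over a grid of directions leaves polynomially many stars.\<close>

section \<open>Importance sampling\<close>

text \<open>The number of stars and their capacities are arbitrary, so the sampling error must be
  relative in every direction and free of the number of stars. Let \<open>M Q\<close> sum the
  largest demands on \<open>Q\<close> over all stars. The total support function at \<delta> is at
  least the largest \<open>\<delta> Q * M Q\<close> and at most \<open>card I\<close> times it. This
  makes a grid of \<open>(m + 1) ^ card I\<close> directions enough, with \<open>m\<close> about
  \<open>card I / \<epsilon>\<close>. The union bound costs \<open>card I * m\<close> in the
  exponent, the total sensitivity a further \<open>card I\<close>, the accuracy
  \<open>1 / \<epsilon>\<^sup>2\<close>: together about \<open>(card I / \<epsilon>) ^ 3\<close>
  samples. Separation without closedness gives inclusion only up to an additive error. It is traded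
  for a factor close to 1 by mixing in a b-matching that is positive on every usable pair.
  Capacities between terminals are copied, not sampled.\<close>

lemma exists_le_weighted_mean:
  fixes p \<phi> :: "'u \<Rightarrow> real"
  assumes "finite U" "\<And>v. v \<in> U \<Longrightarrow> 0 \<le> p v" "sum p U = 1"
  shows "\<exists>x\<in>U. \<phi> x \<le> (\<Sum>v\<in>U. p v * \<phi> v)"
proof -
  have "U \<noteq> {}" using assms(3) by auto
  then obtain x where x: "x \<in> U" "\<And>v. v \<in> U \<Longrightarrow> \<phi> x \<le> \<phi> v"
    using ex_is_arg_min_if_finite[OF assms(1), of \<phi>] by (force simp: is_arg_min_linorder)
  have "\<phi> x = (\<Sum>v\<in>U. p v * \<phi> x)" using assms(3) by (simp flip: sum_distrib_right)
  also have "\<dots> \<le> (\<Sum>v\<in>U. p v * \<phi> v)"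
    by (intro sum_mono mult_left_mono x assms)
  finally show ?thesis using x by blast
qed

text \<open>The method of conditional expectations: independent samples from \<open>p\<close> replaced by greedy
  choices.\<close>

lemma greedy_product:
  fixes p :: "'u \<Rightarrow> real" and a :: "'j \<Rightarrow> 'u \<Rightarrow> real" and A :: real
  assumes U: "finite U" and p: "\<And>v. v \<in> U \<Longrightarrow> 0 \<le> p v" "sum p U = 1"
    and a: "\<And>j v. j \<in> J \<Longrightarrow> v \<in> U \<Longrightarrow> 0 \<le> a j v"
    and A: "\<And>j. j \<in> J \<Longrightarrow> (\<Sum>v\<in>U. p v * a j v) \<le> A" and A0: "0 \<le> A"
  shows "\<exists>x. x ` {..<N} \<subseteq> U \<and> (\<Sum>j\<in>J. \<Prod>i<N. a j (x i)) \<le> card J * A ^ N"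
proof (induction N)
  case 0
  show ?case by simp
next
  case (Suc N)
  then obtain x where x: "x ` {..<N} \<subseteq> U" "(\<Sum>j\<in>J. \<Prod>i<N. a j (x i)) \<le> card J * A ^ N"
    by blast
  define q where "q j = (\<Prod>i<N. a j (x i))" for j
  have q: "0 \<le> q j" if "j \<in> J" for j
    unfolding q_def using x that by (intro prod_nonneg a) auto
  obtain y where y: "y \<in> U" "(\<Sum>j\<in>J. q j * a j y) \<le> (\<Sum>v\<in>U. p v * (\<Sum>j\<in>J. q j * a j v))"
    using exists_le_weighted_mean[OF U p, of "\<lambda>v. \<Sum>j\<in>J. q j * a j v"] by auto
  note y(2)
  also have "(\<Sum>v\<in>U. p v * (\<Sum>j\<in>J. q j * a j v)) = (\<Sum>j\<in>J. q j * (\<Sum>v\<in>U. p v * a j v))"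
    unfolding sum_distrib_left by (subst sum.swap) (simp add: mult_ac)
  also have "\<dots> \<le> (\<Sum>j\<in>J. q j * A)"
    by (intro sum_mono mult_left_mono A q)
  also have "\<dots> = (\<Sum>j\<in>J. q j) * A" by (simp add: sum_distrib_right)
  also have "\<dots> \<le> card J * A ^ Suc N"
    using mult_right_mono[OF x(2) A0] by (simp add: q_def mult_ac)
  finally have *: "(\<Sum>j\<in>J. q j * a j y) \<le> card J * A ^ Suc N" .
  let ?x = "x(N := y)"
  have prod: "(\<Prod>i<Suc N. a j (?x i)) = q j * a j y" for j
    by (auto simp: q_def intro!: prod.cong)
  have "?x ` {..<Suc N} \<subseteq> U"
    using x y by (auto simp: less_Suc_eq)
  moreover have "(\<Sum>j\<in>J. \<Prod>i<Suc N. a j (?x i)) \<le> card J * A ^ Suc N"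
    unfolding prod by (rule *)
  ultimately show ?case by blast
qed

text \<open>The linear term is kept exact so that it cancels on average against deviations of mean
  zero. For negative \<open>x = - y\<close>, the product
  \<open>(1 + y + y\<^sup>2 / 2) * (1 - y + y\<^sup>2)\<close> is at least 1, so
  \<open>1 - y + y\<^sup>2\<close> bounds the reciprocal of \<open>exp y\<close>.\<close>

lemma exp_le_quadratic:
  fixes x :: real
  assumes "\<bar>x\<bar> \<le> 1"
  shows "exp x \<le> 1 + x + x\<^sup>2"
proof (cases "0 \<le> x")
  case True
  then show ?thesis using exp_bound assms by simp
next
  case False
  define y where "y = - x"
  have y: "0 \<le> y" using False by (simp add: y_def)
  have pos: "0 < 1 - y + y\<^sup>2"
    using zero_le_power2[of "y - 1"] zero_le_power2[of y] y by (simp add: power2_eq_square algebra_simps) (smt (verit) mult_nonneg_nonneg)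
  have "1 \<le> (1 + y + y\<^sup>2 / 2) * (1 - y + y\<^sup>2)"
  proof -
    have "(1 + y + y\<^sup>2 / 2) * (1 - y + y\<^sup>2) = 1 + y\<^sup>2/2 + y^3/2 + y^4/2"
      by (simp add: power2_eq_square power3_eq_cube power4_eq_xxxx field_simps)
    then show ?thesis using y by simp
  qed
  also have "\<dots> \<le> exp y * (1 - y + y\<^sup>2)"
    using exp_lower_Taylor_quadratic[OF y] pos by (intro mult_right_mono) auto
  finally have "1 \<le> exp y * (1 - y + y\<^sup>2)" .
  then have "exp (- y) * 1 \<le> exp (- y) * (exp y * (1 - y + y\<^sup>2))"
    by (intro mult_left_mono) auto
  also have "\<dots> = 1 - y + y\<^sup>2"
    by (simp add: mult.assoc[symmetric] exp_minus)
  finally show ?thesis by (simp add: y_def)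
qed

text \<open>Importance sampling with probabilities proportional to the sensitivities \<open>s\<close>; the
  Chernoff bound is carried by the exponential potential of \<open>greedy_product\<close>.\<close>

lemma sensitivity_sampling:
  fixes f :: "'j \<Rightarrow> 'u \<Rightarrow> real" and s :: "'u \<Rightarrow> real"
  assumes U: "finite U" and J: "finite J" and s: "\<And>v. v \<in> U \<Longrightarrow> 0 \<le> s v" and K: "sum s U \<le> K"
    and f: "\<And>j v. j \<in> J \<Longrightarrow> v \<in> U \<Longrightarrow> 0 \<le> f j v"
    and fs: "\<And>j v. j \<in> J \<Longrightarrow> v \<in> U \<Longrightarrow> f j v \<le> s v * sum (f j) U"
    and \<epsilon>: "0 < \<epsilon>" "\<epsilon> \<le> 1" and N: "0 < N" "2 * real (card J) \<le> exp (\<epsilon>\<^sup>2 * real N / (4 * K))"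
  shows "\<exists>w. (\<forall>v. 0 \<le> w v) \<and> card {v\<in>U. 0 < w v} \<le> N \<and>
           (\<forall>j\<in>J. \<bar>(\<Sum>v\<in>U. w v * f j v) - sum (f j) U\<bar> \<le> \<epsilon> * sum (f j) U)"
proof (cases "\<exists>j\<in>J. sum (f j) U > 0")
  case False
  then have "sum (f j) U = 0" if "j \<in> J" for j
    using sum_nonneg[of U "f j"] f[OF that] that by force
  then show ?thesis by (intro exI[of _ "\<lambda>_. 0"]) auto
next
  case True
  define \<mu> where "\<mu> j = sum (f j) U" for j
  define S where "S = sum s U"
  have S1: "1 \<le> S"
  proof -
    obtain j where j: "j \<in> J" "\<mu> j > 0" using True by (auto simp: \<mu>_def)
    have "\<mu> j \<le> S * \<mu> j"
      unfolding S_def sum_distrib_right \<mu>_def using fs[OF j(1)] by (rule sum_mono)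
    then show ?thesis using j by simp
  qed
  \<comment> \<open>This \<theta> minimises
    \<open>\<theta>\<^sup>2 * S - \<theta> * \<epsilon>\<close>; the minimum
    \<open>- \<epsilon>\<^sup>2 / (4 * S)\<close> is the origin of the exponent in the hypothesis on
    \<open>N\<close>. It also keeps \<open>\<theta> * S \<le> 1\<close>, the range of
    \<open>exp_le_quadratic\<close>.\<close>
  define \<theta> where "\<theta> = \<epsilon> / (2 * S)"
  have \<theta>: "0 < \<theta>" using \<epsilon> S1 by (simp add: \<theta>_def)
  define p where "p v = s v / S" for v
  \<comment> \<open>The unbiased estimator \<open>f j v / p v\<close>, normalised by its mean
    \<open>\<mu> j\<close>. Where \<open>s v = 0\<close>, division by zero makes it 0, in agreement
    with \<open>f j v = 0\<close>.\<close>
  define g where "g j v = S * f j v / (s v * \<mu> j)" for j v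
  define J' where "J' = {j\<in>J. \<mu> j > 0}"
  \<comment> \<open>The sign \<sigma> puts both tails into one potential; hence the factor 2 on
    \<open>card J\<close> in the hypothesis on \<open>N\<close>.\<close>
  define a where "a = (\<lambda>(j, \<sigma>) v. exp (\<sigma> * \<theta> * (g j v - 1)))"
  have g: "0 \<le> g j v" "g j v \<le> S" "p v * g j v = f j v / \<mu> j" if "j \<in> J'" "v \<in> U" for j v
  proof -
    have j: "j \<in> J" "\<mu> j > 0" using that by (auto simp: J'_def)
    have *: "f j v \<le> s v * \<mu> j" "0 \<le> f j v" "0 \<le> s v"
      using fs[OF j(1) that(2)] f[OF j(1) that(2)] s[OF that(2)] by (auto simp: \<mu>_def)
    show "0 \<le> g j v" using * j S1 by (simp add: g_def)
    show "g j v \<le> S"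
    proof (cases "s v = 0")
      case False
      then have "0 < s v" using *(3) by linarith
      then have "0 < s v * \<mu> j" using j by simp
      then show ?thesis using * S1 by (simp add: g_def pos_divide_le_eq mult_left_mono)
    qed (use S1 in \<open>simp add: g_def\<close>)
    show "p v * g j v = f j v / \<mu> j"
      using j * S1 by (cases "s v = 0") (auto simp: p_def g_def)
  qed
  have p: "\<And>v. v \<in> U \<Longrightarrow> 0 \<le> p v" "sum p U = 1"
  proof -
    show "0 \<le> p v" if "v \<in> U" for v using s[OF that] S1 by (simp add: p_def)
    show "sum p U = 1" using S1 unfolding p_def by (simp add: S_def flip: sum_divide_distrib)
  qed
  have mean: "(\<Sum>v\<in>U. p v * g j v) = 1" if "j \<in> J'" for j
  proof -
    have "(\<Sum>v\<in>U. p v * g j v) = (\<Sum>v\<in>U. f j v / \<mu> j)"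
      using g that by (intro sum.cong) auto
    then show ?thesis using that by (simp add: J'_def \<mu>_def flip: sum_divide_distrib)
  qed
  have A: "(\<Sum>v\<in>U. p v * a j\<sigma> v) \<le> exp (\<theta>\<^sup>2 * S)" if j\<sigma>: "j\<sigma> \<in> J' \<times> {-1, 1}" for j\<sigma>
  proof -
    obtain j \<sigma> where js: "j\<sigma> = (j, \<sigma>)" "j \<in> J'" "\<sigma> = -1 \<or> \<sigma> = 1"
      using j\<sigma> by (cases j\<sigma>) auto
    have "(\<Sum>v\<in>U. p v * a j\<sigma> v) \<le>
       (\<Sum>v\<in>U. p v * (1 + \<sigma> * \<theta> * (g j v - 1) + \<theta>\<^sup>2 * (S * g j v - 2 * g j v + 1)))"
    proof (intro sum_mono mult_left_mono)
      fix v assume v: "v \<in> U"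
      have "\<bar>\<sigma> * \<theta> * (g j v - 1)\<bar> = \<theta> * \<bar>g j v - 1\<bar>" using js \<theta> by (auto simp: abs_mult)
      also have "\<dots> \<le> \<theta> * S" using g[OF js(2) v] S1 \<theta> by (intro mult_left_mono) auto
      also have "\<dots> \<le> 1" using S1 \<epsilon> by (simp add: \<theta>_def)
      finally have "exp (\<sigma> * \<theta> * (g j v - 1)) \<le> 1 + \<sigma> * \<theta> * (g j v - 1) + (\<sigma> * \<theta> * (g j v - 1))\<^sup>2"
        by (rule exp_le_quadratic)
      also have "(\<sigma> * \<theta> * (g j v - 1))\<^sup>2 = \<theta>\<^sup>2 * (g j v * g j v - 2 * g j v + 1)"
        using js by (auto simp: power2_eq_square algebra_simps)
      \<comment> \<open>Bounding one factor \<open>g j v\<close> by \<open>S\<close> makes the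
        second moment linear in \<open>g\<close>, so that knowing the mean is enough.\<close>
      also have "\<dots> \<le> \<theta>\<^sup>2 * (S * g j v - 2 * g j v + 1)"
        using g[OF js(2) v] by (intro mult_left_mono add_right_mono diff_right_mono mult_right_mono) auto
      finally show "a j\<sigma> v \<le> 1 + \<sigma> * \<theta> * (g j v - 1) + \<theta>\<^sup>2 * (S * g j v - 2 * g j v + 1)"
        by (simp add: a_def js)
    qed (use p in auto)
    also have "\<dots> = (\<Sum>v\<in>U. (1 - \<sigma> * \<theta> + \<theta>\<^sup>2) * p v + (\<sigma> * \<theta> + \<theta>\<^sup>2 * (S - 2)) * (p v * g j v))"
      by (intro sum.cong) (auto simp: algebra_simps)
    also have "\<dots> = (1 - \<sigma> * \<theta> + \<theta>\<^sup>2) + (\<sigma> * \<theta> + \<theta>\<^sup>2 * (S - 2))"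
      using mean[OF js(2)] p(2) by (simp add: sum.distrib flip: sum_distrib_left)
    also have "\<dots> \<le> 1 + \<theta>\<^sup>2 * S" by (simp add: algebra_simps)
    also have "\<dots> \<le> exp (\<theta>\<^sup>2 * S)" by (rule exp_ge_add_one_self)
    finally show ?thesis .
  qed
  have "\<exists>x. x ` {..<N} \<subseteq> U \<and>
      (\<Sum>j\<sigma>\<in>J' \<times> {-1, 1}. \<Prod>i<N. a j\<sigma> (x i)) \<le> card (J' \<times> {-1, 1 :: real}) * exp (\<theta>\<^sup>2 * S) ^ N"
    by (rule greedy_product[OF U p _ A]) (auto simp: a_def)
  then obtain x where x: "x ` {..<N} \<subseteq> U"
    and Phi: "(\<Sum>j\<sigma>\<in>J' \<times> {-1, 1}. \<Prod>i<N. a j\<sigma> (x i)) \<le> card (J' \<times> {-1, 1 :: real}) * exp (\<theta>\<^sup>2 * S) ^ N"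
    by blast
  have cJ: "real (card (J' \<times> {-1, 1 :: real})) \<le> 2 * real (card J)"
    using J card_mono[of J J'] by (simp add: card_cartesian_product J'_def)
  have dev: "\<sigma> * (\<Sum>i<N. g j (x i) - 1) \<le> \<epsilon> * N" if "j \<in> J'" "\<sigma> \<in> {-1, 1}" for j \<sigma>
  proof (rule ccontr)
    assume "\<not> ?thesis"
    \<comment> \<open>Markov's inequality in disguise: a single bad pair
      \<open>(j, \<sigma>)\<close> would add to the potential a term larger than the bound on the
      whole sum.\<close>
    then have "\<theta> * (\<epsilon> * N) < \<theta> * (\<sigma> * (\<Sum>i<N. g j (x i) - 1))" using \<theta> by simp
    then have "exp (\<theta> * \<epsilon> * N) < exp (\<theta> * (\<sigma> * (\<Sum>i<N. g j (x i) - 1)))" by (simp add: mult.assoc)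
    also have "\<dots> = (\<Prod>i<N. a (j, \<sigma>) (x i))"
      by (simp add: a_def exp_sum sum_distrib_left mult_ac)
    also have "\<dots> \<le> (\<Sum>j\<sigma>\<in>J' \<times> {-1, 1}. \<Prod>i<N. a j\<sigma> (x i))"
      using that J by (intro member_le_sum) (auto simp: J'_def a_def intro!: prod_nonneg)
    also note Phi
    also have "card (J' \<times> {-1, 1 :: real}) * exp (\<theta>\<^sup>2 * S) ^ N \<le> exp (\<epsilon>\<^sup>2 * real N / (4 * K)) * exp (\<theta>\<^sup>2 * S) ^ N"
      using cJ N by (intro mult_right_mono) auto
    also have "\<dots> \<le> exp (\<epsilon>\<^sup>2 * real N / (4 * S)) * exp (\<theta>\<^sup>2 * S) ^ N"
      using S1 K by (intro mult_right_mono) (auto simp: S_def intro!: divide_left_mono)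
    also have "\<dots> = exp (\<epsilon>\<^sup>2 * real N / (4 * S) + real N * (\<theta>\<^sup>2 * S))"
      by (simp add: exp_add exp_of_nat_mult)
    also have "\<epsilon>\<^sup>2 * real N / (4 * S) + real N * (\<theta>\<^sup>2 * S) = \<theta> * \<epsilon> * N"
      using S1 by (simp add: \<theta>_def field_simps power2_eq_square)
    finally show False by simp
  qed
  \<comment> \<open>Each sample with \<open>x i = v\<close> contributes
    \<open>1 / (N * p v)\<close>.\<close>
  define w where "w v = (\<Sum>i<N. if x i = v then S / (N * s (x i)) else 0)" for v
  have w0: "0 \<le> w v" for v
  proof -
    have "0 \<le> s (x i)" if "i < N" for i using x s that by auto
    then show ?thesis unfolding w_def using S1 by (intro sum_nonneg) auto
  qed
  have "{v\<in>U. 0 < w v} \<subseteq> x ` {..<N}"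
  proof
    fix v assume "v \<in> {v\<in>U. 0 < w v}"
    then have "w v \<noteq> 0" by auto
    then show "v \<in> x ` {..<N}" unfolding w_def by (force elim: sum.not_neutral_contains_not_neutral split: if_splits)
  qed
  then have "card {v\<in>U. 0 < w v} \<le> card {..<N}"
    by (meson card_image_le card_mono finite_imageI finite_lessThan le_trans)
  then have card: "card {v\<in>U. 0 < w v} \<le> N" by simp
  have "\<bar>(\<Sum>v\<in>U. w v * f j v) - \<mu> j\<bar> \<le> \<epsilon> * \<mu> j" if j: "j \<in> J" for j
  proof (cases "\<mu> j > 0")
    case False
    then have m: "\<mu> j = 0" using f[OF j] by (simp add: \<mu>_def sum_nonneg order_antisym not_less)
    then have "f j v = 0" if "v \<in> U" for v
      using f[OF j] U that by (simp add: \<mu>_def sum_nonneg_eq_0_iff)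
    then show ?thesis using m by simp
  next
    case True
    then have j': "j \<in> J'" using j by (simp add: J'_def)
    have "(\<Sum>v\<in>U. w v * f j v) = (\<Sum>i<N. \<Sum>v\<in>U. if x i = v then S / (N * s v) * f j v else 0)"
      unfolding w_def sum_distrib_right by (subst sum.swap) (auto intro!: sum.cong)
    also have "\<dots> = (\<Sum>i<N. \<mu> j / N * g j (x i))"
      using x True U N by (intro sum.cong) (auto simp: g_def sum.delta')
    also have "\<dots> = \<mu> j / N * (\<Sum>i<N. g j (x i))" by (simp add: sum_distrib_left)
    also have "\<dots> - \<mu> j = \<mu> j / N * (\<Sum>i<N. g j (x i) - 1)"
      using N by (simp add: sum_subtractf algebra_simps)
    also have "\<bar>\<dots>\<bar> = \<mu> j / N * \<bar>\<Sum>i<N. g j (x i) - 1\<bar>" using True by (simp add: abs_mult)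
    also have "\<dots> \<le> \<mu> j / N * (\<epsilon> * N)"
      using dev[OF j', of 1] dev[OF j', of "-1"] True by (intro mult_left_mono) auto
    finally show ?thesis using N by (simp add: mult.commute)
  qed
  then show ?thesis using w0 card unfolding \<mu>_def by blast
qed

section \<open>Separation\<close>

text \<open>Lets a truncated square be expanded as an ordinary square around the positive part. If
  \<open>a - h\<close> is positive, then \<open>0 < a - h \<le> max 0 a - h\<close>; otherwise the
  left side vanishes.\<close>

lemma positive_part_diff_square_le:
  fixes a h :: real
  shows "(max 0 (a - h))\<^sup>2 \<le> (max 0 a - h)\<^sup>2"
proof (cases "a - h \<le> 0")
  case False
  then have *: "0 \<le> a - h" "a - h \<le> max 0 a - h" by auto
  then show ?thesis by (simp add: max_def power_mono)
qed simp

text \<open>A near-minimiser \<open>z0\<close> of the squared distance from \<open>x\<close> stands in for the projection, so the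
  set need not be closed. Only positive excesses are measured, so the separating \<open>\<delta>\<close> is
  nonnegative.\<close>

lemma convex_approximation:
  fixes S :: "('i \<Rightarrow> real) set" and x :: "'i \<Rightarrow> real"
  assumes I: "finite I" and ne: "S \<noteq> {}"
    and conv: "\<And>z z' t. z \<in> S \<Longrightarrow> z' \<in> S \<Longrightarrow> 0 \<le> t \<Longrightarrow> t \<le> 1 \<Longrightarrow> (\<lambda>Q. (1 - t) * z Q + t * z' Q) \<in> S"
    and bnd: "\<And>z Q. z \<in> S \<Longrightarrow> Q \<in> I \<Longrightarrow> 0 \<le> z Q \<and> z Q \<le> B"
    and sup: "\<And>\<delta> \<eta>. (\<And>Q. 0 \<le> \<delta> Q) \<Longrightarrow> 0 < \<eta> \<Longrightarrow>
                 \<exists>z\<in>S. (\<Sum>Q\<in>I. \<delta> Q * x Q) - \<eta> < (\<Sum>Q\<in>I. \<delta> Q * z Q)"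
    and \<eta>: "0 < \<eta>"
  shows "\<exists>z\<in>S. \<forall>Q\<in>I. x Q \<le> z Q + \<eta>"
proof (rule ccontr)
  assume "\<not> ?thesis"
  then have far: "\<exists>Q\<in>I. z Q + \<eta> < x Q" if "z \<in> S" for z using that by force
  define \<phi> where "\<phi> z = (\<Sum>Q\<in>I. (max 0 (x Q - z Q))\<^sup>2)" for z
  have far': "\<eta>\<^sup>2 \<le> \<phi> z" if z: "z \<in> S" for z
  proof -
    obtain Q where Q: "Q \<in> I" "z Q + \<eta> < x Q" using far[OF z] by blast
    have "\<eta>\<^sup>2 \<le> (max 0 (x Q - z Q))\<^sup>2" using Q \<eta> by (intro power_mono) auto
    also have "\<dots> \<le> \<phi> z" unfolding \<phi>_def using I Q by (intro member_le_sum) auto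
    finally show ?thesis .
  qed
  define \<rho> where "\<rho> = Inf (\<phi> ` S)"
  have "\<eta>\<^sup>2 \<le> \<rho>" unfolding \<rho>_def using far' ne by (intro cInf_greatest) auto
  then have \<rho>: "0 < \<rho>" using \<eta> by (smt (verit) zero_less_power)
  have below: "bdd_below (\<phi> ` S)" using far' by (intro bdd_belowI2)
  have \<rho>_le: "\<rho> \<le> \<phi> z" if "z \<in> S" for z
    unfolding \<rho>_def using below that by (intro cInf_lower) auto
  define d where "d = real (card I) * B\<^sup>2"
  have d0: "0 \<le> d" by (simp add: d_def)
  \<comment> \<open>\<open>d\<close> bounds the squared distance between members of
    \<open>S\<close>. The step \<open>t\<close> is so short that the second-order term
    \<open>t\<^sup>2 * d\<close> is at most \<open>\<rho> * t / 2\<close>, which is also the slack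
    granted to \<open>z0\<close> below.\<close>
  define t where "t = min 1 (\<rho> / (2 * d + 1))"
  have t: "0 < t" "t \<le> 1" using \<rho> d0 by (auto simp: t_def)
  have td: "t * d \<le> \<rho> / 2"
  proof -
    have "t * d \<le> \<rho> / (2 * d + 1) * d" using d0 by (intro mult_right_mono) (auto simp: t_def)
    also have "\<dots> \<le> \<rho> / 2" using \<rho> d0 by (simp add: field_simps)
    finally show ?thesis .
  qed
  have "\<exists>r\<in>\<phi> ` S. r < \<rho> + \<rho> * t / 2"
    using cInf_lessD[of "\<phi> ` S" "\<rho> + \<rho> * t / 2"] ne \<rho> t by (simp add: \<rho>_def)
  then obtain z0 where z0: "z0 \<in> S" "\<phi> z0 < \<rho> + \<rho> * t / 2" by blast
  define \<delta> where "\<delta> Q = max 0 (x Q - z0 Q)" for Q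
  \<comment> \<open>Approximate first-order optimality: moving from \<open>z0\<close> towards
    \<open>z\<close> cannot bring the squared distance below \<rho>. The two errors
    \<open>\<rho> * t / 2\<close>, divided by \<open>2 * t\<close>, leave
    \<open>\<rho> / 2\<close>.\<close>
  have dz: "(\<Sum>Q\<in>I. \<delta> Q * (z Q - z0 Q)) \<le> \<rho> / 2" if z: "z \<in> S" for z
  proof -
    have zS: "(\<lambda>Q. (1 - t) * z0 Q + t * z Q) \<in> S" using conv z z0 t by simp
    have sq: "(z Q - z0 Q)\<^sup>2 \<le> B\<^sup>2" if "Q \<in> I" for Q
      using bnd[OF z that] bnd[OF z0(1) that] by (subst abs_le_square_iff[symmetric]) auto
    have "\<rho> \<le> \<phi> (\<lambda>Q. (1 - t) * z0 Q + t * z Q)" by (rule \<rho>_le[OF zS])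
    also have "\<dots> = (\<Sum>Q\<in>I. (max 0 ((x Q - z0 Q) - t * (z Q - z0 Q)))\<^sup>2)"
      by (simp add: \<phi>_def algebra_simps)
    also have "\<dots> \<le> (\<Sum>Q\<in>I. (\<delta> Q - t * (z Q - z0 Q))\<^sup>2)"
      unfolding \<delta>_def by (intro sum_mono positive_part_diff_square_le)
    also have "\<dots> = (\<Sum>Q\<in>I. (\<delta> Q)\<^sup>2 - 2 * t * (\<delta> Q * (z Q - z0 Q)) + t\<^sup>2 * (z Q - z0 Q)\<^sup>2)"
      by (intro sum.cong) (auto simp: power2_eq_square algebra_simps)
    also have "\<dots> \<le> (\<Sum>Q\<in>I. (\<delta> Q)\<^sup>2 - 2 * t * (\<delta> Q * (z Q - z0 Q)) + t\<^sup>2 * B\<^sup>2)"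
      using sq by (intro sum_mono add_left_mono mult_left_mono) auto
    also have "\<dots> = \<phi> z0 - 2 * t * (\<Sum>Q\<in>I. \<delta> Q * (z Q - z0 Q)) + t\<^sup>2 * d"
      by (simp add: sum.distrib sum_subtractf \<phi>_def \<delta>_def d_def flip: sum_distrib_left)
    finally have "2 * t * (\<Sum>Q\<in>I. \<delta> Q * (z Q - z0 Q)) \<le> \<rho> * t / 2 + t * (t * d)"
      using z0(2) by (simp add: power2_eq_square mult.assoc)
    also have "\<dots> \<le> \<rho> * t / 2 + t * (\<rho> / 2)" using td t by (intro add_left_mono mult_left_mono) auto
    also have "\<dots> = 2 * t * (\<rho> / 2)" by simp
    finally show ?thesis using t by simp
  qed
  obtain z where z: "z \<in> S" "(\<Sum>Q\<in>I. \<delta> Q * x Q) - \<rho> / 2 < (\<Sum>Q\<in>I. \<delta> Q * z Q)"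
    using sup[of \<delta> "\<rho> / 2"] \<rho> by (auto simp: \<delta>_def)
  \<comment> \<open>In direction \<delta>, \<open>x\<close> exceeds \<open>z\<close> by less than
    \<open>\<rho> / 2\<close> and \<open>z\<close> exceeds \<open>z0\<close> by at most
    \<open>\<rho> / 2\<close>; together this is less than \<open>\<phi> z0\<close>.\<close>
  have "\<rho> \<le> \<phi> z0" by (rule \<rho>_le[OF z0(1)])
  also have "\<dots> = (\<Sum>Q\<in>I. \<delta> Q * (x Q - z0 Q))"
    unfolding \<phi>_def by (intro sum.cong) (auto simp: \<delta>_def max_def power2_eq_square)
  finally show False using dz[OF z(1)] z(2)
    by (simp add: right_diff_distrib sum_subtractf)
qed

section \<open>Sums of b-matching polytopes\<close>

definition bmatchings :: "'a set set \<Rightarrow> 'a set \<Rightarrow> ('a \<Rightarrow> real) \<Rightarrow> ('a set \<Rightarrow> real) set" where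
  "bmatchings I T c = {d. (\<forall>Q\<in>I. 0 \<le> d Q) \<and> (\<forall>s\<in>T. (\<Sum>Q | Q \<in> I \<and> s \<in> Q. d Q) \<le> c s)}"

text \<open>The largest demand that \<open>Q\<close> can carry: the degree constraints impose it
  (\<open>bmatching_le_edge_bound\<close>), and for nonnegative \<open>c\<close> it is attained
  (\<open>single_bmatching\<close>).\<close>

definition edge_bound :: "('a \<Rightarrow> real) \<Rightarrow> 'a set \<Rightarrow> real" where
  "edge_bound c Q = Min (c ` Q)"

text \<open>The support function of the polytope. For nonnegative \<open>c\<close> and \<delta> the
  supremum is over a nonempty bounded set, by \<open>zero_bmatching\<close> and
  \<open>bmatching_weight_le\<close>.\<close>

definition matching_value ::
  "'a set set \<Rightarrow> 'a set \<Rightarrow> ('a \<Rightarrow> real) \<Rightarrow> ('a set \<Rightarrow> real) \<Rightarrow> real" where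
  "matching_value I T c \<delta> = Sup ((\<lambda>d. \<Sum>Q\<in>I. \<delta> Q * d Q) ` bmatchings I T c)"

definition bmatching_sum ::
  "'a set set \<Rightarrow> 'a set \<Rightarrow> 'u set \<Rightarrow> ('u \<Rightarrow> 'a \<Rightarrow> real) \<Rightarrow> ('u \<Rightarrow> real) \<Rightarrow> ('a set \<Rightarrow> real) set" where
  "bmatching_sum I T U b w =
     {x. (\<forall>Q\<in>I. 0 \<le> x Q) \<and>
         (\<exists>D. (\<forall>v\<in>U. D v \<in> bmatchings I T (b v)) \<and> (\<forall>Q\<in>I. x Q \<le> (\<Sum>v\<in>U. w v * D v Q)))}"

lemma bmatchings_convex:
  assumes "d \<in> bmatchings I T c" "d' \<in> bmatchings I T c" "0 \<le> t" "t \<le> 1"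
  shows "(\<lambda>Q. (1 - t) * d Q + t * d' Q) \<in> bmatchings I T c"
proof -
  have "(\<Sum>Q | Q \<in> I \<and> s \<in> Q. (1 - t) * d Q + t * d' Q) \<le> c s" if "s \<in> T" for s
  proof -
    have "(\<Sum>Q | Q \<in> I \<and> s \<in> Q. (1 - t) * d Q + t * d' Q) =
        (1 - t) * (\<Sum>Q | Q \<in> I \<and> s \<in> Q. d Q) + t * (\<Sum>Q | Q \<in> I \<and> s \<in> Q. d' Q)"
      by (simp add: sum.distrib sum_distrib_left)
    also have "\<dots> \<le> (1 - t) * c s + t * c s"
      using assms that unfolding bmatchings_def by (intro add_mono mult_left_mono) auto
    finally show ?thesis by (simp add: algebra_simps)
  qed
  then show ?thesis using assms unfolding bmatchings_def by auto
qed

lemma bmatching_sum_scale: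
  assumes x: "x \<in> bmatching_sum I T U b w" and r: "0 \<le> r" "\<And>v. v \<in> U \<Longrightarrow> r * w v \<le> w' v"
    and y: "\<And>Q. Q \<in> I \<Longrightarrow> 0 \<le> y Q \<and> y Q \<le> r * x Q"
  shows "y \<in> bmatching_sum I T U b w'"
proof -
  obtain D where D: "\<And>v. v \<in> U \<Longrightarrow> D v \<in> bmatchings I T (b v)"
      "\<And>Q. Q \<in> I \<Longrightarrow> x Q \<le> (\<Sum>v\<in>U. w v * D v Q)"
    using x unfolding bmatching_sum_def by blast
  have "y Q \<le> (\<Sum>v\<in>U. w' v * D v Q)" if Q: "Q \<in> I" for Q
  proof -
    have "y Q \<le> r * x Q" using y Q by blast
    also have "\<dots> \<le> r * (\<Sum>v\<in>U. w v * D v Q)" using D(2) Q r(1) by (intro mult_left_mono)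
    also have "\<dots> = (\<Sum>v\<in>U. (r * w v) * D v Q)" by (simp add: sum_distrib_left mult.assoc)
    also have "\<dots> \<le> (\<Sum>v\<in>U. w' v * D v Q)"
      using D(1) Q r(2) by (intro sum_mono mult_right_mono) (auto simp: bmatchings_def)
    finally show ?thesis .
  qed
  then show ?thesis using y D(1) unfolding bmatching_sum_def by blast
qed

locale demand_pairs =
  fixes I :: "'a set set" and T :: "'a set"
  assumes finite_I: "finite I" and finite_T: "finite T"
    and pair: "Q \<in> I \<Longrightarrow> Q \<subseteq> T \<and> Q \<noteq> {}"
begin

lemma finite_pair: "Q \<in> I \<Longrightarrow> finite Q"
  using pair finite_T finite_subset by blast

lemma edge_bound_nonneg:
  assumes "\<And>s. s \<in> T \<Longrightarrow> 0 \<le> c s" "Q \<in> I"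
  shows "0 \<le> edge_bound c Q"
  using assms pair[OF assms(2)] finite_pair[OF assms(2)] by (auto simp: edge_bound_def)

lemma edge_bound_le:
  assumes "Q \<in> I" "s \<in> Q"
  shows "edge_bound c Q \<le> c s"
  using assms finite_pair[OF assms(1)] by (auto simp: edge_bound_def)

lemma bmatching_le_edge_bound:
  assumes d: "d \<in> bmatchings I T c" and Q: "Q \<in> I"
  shows "d Q \<le> edge_bound c Q"
proof -
  have "d Q \<le> c s" if s: "s \<in> Q" for s
  proof -
    have "d Q \<le> (\<Sum>Q | Q \<in> I \<and> s \<in> Q. d Q)"
      by (rule member_le_sum) (use d Q s finite_I in \<open>auto simp: bmatchings_def\<close>)
    also have "\<dots> \<le> c s" using d pair[OF Q] s by (auto simp: bmatchings_def)
    finally show ?thesis .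
  qed
  then show ?thesis using pair[OF Q] finite_pair[OF Q] by (simp add: edge_bound_def)
qed

text \<open>The average of the single-pair b-matchings. It is positive on every pair that any
  b-matching can use, which turns an additive error into a factor in
  \<open>bmatching_sum_subset\<close>.\<close>

lemma uniform_bmatching:
  assumes c: "\<And>s. s \<in> T \<Longrightarrow> 0 \<le> c s"
  shows "(\<lambda>Q. edge_bound c Q / card I) \<in> bmatchings I T c"
proof -
  have "(\<Sum>Q | Q \<in> I \<and> s \<in> Q. edge_bound c Q / card I) \<le> c s" if s: "s \<in> T" for s
  proof -
    have "(\<Sum>Q | Q \<in> I \<and> s \<in> Q. edge_bound c Q / card I) \<le> (\<Sum>Q | Q \<in> I \<and> s \<in> Q. c s / card I)"
      by (intro sum_mono divide_right_mono) (auto intro: edge_bound_le)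
    also have "\<dots> \<le> (\<Sum>Q\<in>I. c s / card I)"
      using finite_I c[OF s] by (intro sum_mono2) auto
    also have "\<dots> \<le> c s" using c[OF s] by (cases "card I = 0") auto
    finally show ?thesis .
  qed
  then show ?thesis using edge_bound_nonneg[of c] c unfolding bmatchings_def by simp
qed

lemma single_bmatching:
  assumes c: "\<And>s. s \<in> T \<Longrightarrow> 0 \<le> c s" and Q: "Q \<in> I"
  shows "(\<lambda>Q'. if Q' = Q then edge_bound c Q else 0) \<in> bmatchings I T c"
proof -
  have "(\<Sum>Q' | Q' \<in> I \<and> s \<in> Q'. if Q' = Q then edge_bound c Q else 0) \<le> c s" if s: "s \<in> T" for s
  proof (cases "s \<in> Q")
    case True
    then show ?thesis using finite_I Q edge_bound_le[OF Q True] by simp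
  next
    case False
    then have "(\<Sum>Q' | Q' \<in> I \<and> s \<in> Q'. if Q' = Q then edge_bound c Q else 0) = 0"
      by (intro sum.neutral) auto
    then show ?thesis using c[OF s] by simp
  qed
  then show ?thesis using edge_bound_nonneg[of c, OF c Q] unfolding bmatchings_def by simp
qed

lemma zero_bmatching:
  assumes "\<And>s. s \<in> T \<Longrightarrow> 0 \<le> c s"
  shows "(\<lambda>_. 0) \<in> bmatchings I T c"
  using assms by (simp add: bmatchings_def)

section \<open>The support function of one b-matching polytope\<close>

context
  fixes c :: "'a \<Rightarrow> real"
  assumes c: "\<And>s. s \<in> T \<Longrightarrow> 0 \<le> c s"
begin

lemma matching_value_least:
  assumes "\<And>d. d \<in> bmatchings I T c \<Longrightarrow> (\<Sum>Q\<in>I. \<delta> Q * d Q) \<le> r"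
  shows "matching_value I T c \<delta> \<le> r"
  unfolding matching_value_def
proof (rule cSup_least)
  show "(\<lambda>d. \<Sum>Q\<in>I. \<delta> Q * d Q) ` bmatchings I T c \<noteq> {}"
    unfolding image_is_empty using zero_bmatching[of c, OF c] by (metis empty_iff)
qed (auto intro: assms)

lemma bmatching_weight_le:
  assumes "\<And>Q. Q \<in> I \<Longrightarrow> 0 \<le> \<delta> Q" "d \<in> bmatchings I T c"
  shows "(\<Sum>Q\<in>I. \<delta> Q * d Q) \<le> (\<Sum>Q\<in>I. \<delta> Q * edge_bound c Q)"
  using assms bmatching_le_edge_bound by (intro sum_mono mult_left_mono) auto

lemma matching_value_le:
  assumes "\<And>Q. Q \<in> I \<Longrightarrow> 0 \<le> \<delta> Q"
  shows "matching_value I T c \<delta> \<le> (\<Sum>Q\<in>I. \<delta> Q * edge_bound c Q)"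
  using bmatching_weight_le[OF assms] by (rule matching_value_least)

lemma matching_value_upper:
  assumes "\<And>Q. Q \<in> I \<Longrightarrow> 0 \<le> \<delta> Q" "d \<in> bmatchings I T c"
  shows "(\<Sum>Q\<in>I. \<delta> Q * d Q) \<le> matching_value I T c \<delta>"
  unfolding matching_value_def
proof (rule cSup_upper)
  show "bdd_above ((\<lambda>d. \<Sum>Q\<in>I. \<delta> Q * d Q) ` bmatchings I T c)"
    using bmatching_weight_le[OF assms(1)] by (rule bdd_aboveI2)
qed (use assms in auto)

lemma matching_value_approx:
  assumes "0 < \<eta>"
  shows "\<exists>d\<in>bmatchings I T c. matching_value I T c \<delta> - \<eta> < (\<Sum>Q\<in>I. \<delta> Q * d Q)"
proof (rule ccontr)
  assume "\<not> ?thesis"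
  then have "matching_value I T c \<delta> \<le> matching_value I T c \<delta> - \<eta>"
    by (intro matching_value_least) force
  then show False using assms by simp
qed

lemma matching_value_ge:
  assumes "\<And>Q. Q \<in> I \<Longrightarrow> 0 \<le> \<delta> Q" "Q \<in> I"
  shows "\<delta> Q * edge_bound c Q \<le> matching_value I T c \<delta>"
proof -
  have "\<delta> Q * edge_bound c Q = (\<Sum>Q'\<in>I. \<delta> Q' * (if Q' = Q then edge_bound c Q else 0))"
    using finite_I assms(2) by (simp add: sum.delta if_distrib cong: if_cong)
  also have "\<dots> \<le> matching_value I T c \<delta>"
    using single_bmatching[of c, OF c assms(2)] assms(1) by (intro matching_value_upper) auto
  finally show ?thesis .
qed

lemma matching_value_nonneg:
  assumes "\<And>Q. Q \<in> I \<Longrightarrow> 0 \<le> \<delta> Q"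
  shows "0 \<le> matching_value I T c \<delta>"
  using matching_value_upper[OF assms zero_bmatching[of c, OF c]] by simp

text \<open>Sublinearity and monotonicity in one. Directions are compared only where
  \<open>edge_bound c Q\<close> is positive, because every b-matching vanishes elsewhere; the
  rounding in \<open>sparsify_matching_values\<close> relies on this at pairs with
  \<open>M Q = 0\<close>.\<close>

lemma matching_value_combine:
  assumes \<delta>: "\<And>Q. Q \<in> I \<Longrightarrow> 0 < edge_bound c Q \<Longrightarrow> \<delta> Q \<le> r * \<delta>1 Q + r' * \<delta>2 Q"
    and nonneg: "0 \<le> r" "0 \<le> r'" "\<And>Q. Q \<in> I \<Longrightarrow> 0 \<le> \<delta>1 Q" "\<And>Q. Q \<in> I \<Longrightarrow> 0 \<le> \<delta>2 Q"
  shows "matching_value I T c \<delta> \<le> r * matching_value I T c \<delta>1 + r' * matching_value I T c \<delta>2"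
proof (rule matching_value_least)
  fix d assume d: "d \<in> bmatchings I T c"
  have "\<delta> Q * d Q \<le> r * (\<delta>1 Q * d Q) + r' * (\<delta>2 Q * d Q)" if Q: "Q \<in> I" for Q
  proof (cases "d Q = 0")
    case False
    then have dQ: "0 < d Q" using d Q by (auto simp: bmatchings_def less_le)
    then have "0 < edge_bound c Q" using bmatching_le_edge_bound[OF d Q] by linarith
    then have "\<delta> Q * d Q \<le> (r * \<delta>1 Q + r' * \<delta>2 Q) * d Q"
      using \<delta>[OF Q] dQ by (intro mult_right_mono) auto
    then show ?thesis by (simp add: algebra_simps)
  qed simp
  then have "(\<Sum>Q\<in>I. \<delta> Q * d Q) \<le> (\<Sum>Q\<in>I. r * (\<delta>1 Q * d Q) + r' * (\<delta>2 Q * d Q))"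
    by (rule sum_mono)
  also have "\<dots> = r * (\<Sum>Q\<in>I. \<delta>1 Q * d Q) + r' * (\<Sum>Q\<in>I. \<delta>2 Q * d Q)"
    by (simp add: sum.distrib sum_distrib_left)
  also have "\<dots> \<le> r * matching_value I T c \<delta>1 + r' * matching_value I T c \<delta>2"
    using nonneg d by (intro add_mono mult_left_mono matching_value_upper) auto
  finally show "(\<Sum>Q\<in>I. \<delta> Q * d Q) \<le> \<dots>" .
qed

end

section \<open>From domination of support functions to inclusion\<close>

context
  fixes U :: "'u set" and b :: "'u \<Rightarrow> 'a \<Rightarrow> real"
  assumes finite_U: "finite U" and b: "\<And>v s. v \<in> U \<Longrightarrow> s \<in> T \<Longrightarrow> 0 \<le> b v s"
begin

text \<open>Domination of support functions brings \<open>x\<close> within any additive \<eta> of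
  the sum with weights \<open>w\<close>. Shrinking by \<open>q\<close> frees a share of that sum for
  \<open>uniform_bmatching\<close>, whose contribution covers \<eta> on every coordinate that can be
  positive.\<close>

lemma bmatching_sum_subset:
  assumes w: "\<And>v. v \<in> U \<Longrightarrow> 0 \<le> w v" "\<And>v. v \<in> U \<Longrightarrow> 0 \<le> w' v"
    and le: "\<And>\<delta>. (\<And>Q. Q \<in> I \<Longrightarrow> 0 \<le> \<delta> Q) \<Longrightarrow>
       (\<Sum>v\<in>U. w' v * matching_value I T (b v) \<delta>) \<le> (\<Sum>v\<in>U. w v * matching_value I T (b v) \<delta>)"
    and q: "1 < q" and x: "x \<in> bmatching_sum I T U b w'"
  shows "(\<lambda>Q. x Q / q) \<in> bmatching_sum I T U b w"
proof -
  define S where "S = bmatching_sum I T U b w"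
  define M where "M Q = (\<Sum>v\<in>U. w v * edge_bound (b v) Q)" for Q
  have M0: "0 \<le> M Q" if "Q \<in> I" for Q
    unfolding M_def using w b that by (intro sum_nonneg mult_nonneg_nonneg edge_bound_nonneg) auto
  obtain D' where D': "\<And>v. v \<in> U \<Longrightarrow> D' v \<in> bmatchings I T (b v)"
      "\<And>Q. Q \<in> I \<Longrightarrow> x Q \<le> (\<Sum>v\<in>U. w' v * D' v Q)" and x0: "\<And>Q. Q \<in> I \<Longrightarrow> 0 \<le> x Q"
    using x unfolding bmatching_sum_def by blast
  have x_le: "(\<Sum>Q\<in>I. \<delta> Q * x Q) \<le> (\<Sum>v\<in>U. w v * matching_value I T (b v) \<delta>)"
    if \<delta>: "\<And>Q. Q \<in> I \<Longrightarrow> 0 \<le> \<delta> Q" for \<delta>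
  proof -
    have "(\<Sum>Q\<in>I. \<delta> Q * x Q) \<le> (\<Sum>Q\<in>I. \<delta> Q * (\<Sum>v\<in>U. w' v * D' v Q))"
      using D' \<delta> by (intro sum_mono mult_left_mono) auto
    also have "\<dots> = (\<Sum>v\<in>U. w' v * (\<Sum>Q\<in>I. \<delta> Q * D' v Q))"
      unfolding sum_distrib_left by (subst sum.swap) (simp add: mult_ac)
    also have "\<dots> \<le> (\<Sum>v\<in>U. w' v * matching_value I T (b v) \<delta>)"
      using w \<delta> D' b by (intro sum_mono mult_left_mono matching_value_upper) auto
    also have "\<dots> \<le> (\<Sum>v\<in>U. w v * matching_value I T (b v) \<delta>)" by (rule le[of \<delta>, OF \<delta>])
    finally show ?thesis .
  qed
  have x_le_M: "x Q \<le> M Q" if Q: "Q \<in> I" for Q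
  proof -
    \<comment> \<open>Tests the unit direction at \<open>Q\<close>. In particular a coordinate with
      \<open>M Q = 0\<close> is 0 in \<open>x\<close>, so it needs no padding.\<close>
    define e :: "'a set \<Rightarrow> real" where "e Q' = (if Q' = Q then 1 else 0)" for Q'
    have "x Q = (\<Sum>Q'\<in>I. e Q' * x Q')"
      using finite_I Q by (simp add: e_def if_distrib[of "\<lambda>r. r * _"] cong: if_cong)
    also have "\<dots> \<le> (\<Sum>v\<in>U. w v * matching_value I T (b v) e)"
      by (rule x_le) (simp add: e_def)
    also have "\<dots> \<le> (\<Sum>v\<in>U. w v * (\<Sum>Q'\<in>I. e Q' * edge_bound (b v) Q'))"
      using w b by (intro sum_mono mult_left_mono matching_value_le) (auto simp: e_def)
    also have "\<dots> = M Q"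
      using finite_I Q by (simp add: M_def e_def if_distrib[of "\<lambda>r. r * _"] cong: if_cong)
    finally show ?thesis .
  qed
  \<comment> \<open>\<eta> must not exceed any padding that the uniform b-matchings will supply; the
    element 1 covers the case that no \<open>M Q\<close> is positive.\<close>
  define A where "A = insert 1 ((\<lambda>Q. (q - 1) * M Q / card I) ` {Q\<in>I. 0 < M Q})"
  define \<eta> where "\<eta> = Min A"
  have A: "finite A" "A \<noteq> {}" unfolding A_def using finite_I by simp_all
  have "0 < (q - 1) * M Q / card I" if "Q \<in> I" "0 < M Q" for Q
  proof -
    have "0 < card I" using finite_I that(1) card_gt_0_iff by blast
    then show ?thesis using q that(2) by simp
  qed
  then have "0 < r" if "r \<in> A" for r using that unfolding A_def by force
  then have \<eta>0: "0 < \<eta>" unfolding \<eta>_def using Min_in[OF A] by blast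
  have \<eta>: "\<eta> \<le> (q - 1) * M Q / card I" if "Q \<in> I" "0 < M Q" for Q
    unfolding \<eta>_def using that by (intro Min_le[OF A(1)]) (unfold A_def, blast)
  have "\<exists>z\<in>S. \<forall>Q\<in>I. x Q \<le> z Q + \<eta>"
  proof (rule convex_approximation[OF finite_I _ _ _ _ \<eta>0])
    have "(\<lambda>_. 0) \<in> S"
      unfolding S_def bmatching_sum_def using zero_bmatching[of "b _", OF b]
      by (auto intro!: exI[of _ "\<lambda>_ _. 0"])
    then show "S \<noteq> {}" by blast
  next
    fix z z' and t :: real
    assume z: "z \<in> S" "z' \<in> S" and t: "0 \<le> t" "t \<le> 1"
    obtain D where D: "\<And>v. v \<in> U \<Longrightarrow> D v \<in> bmatchings I T (b v)"
      "\<And>Q. Q \<in> I \<Longrightarrow> 0 \<le> z Q" "\<And>Q. Q \<in> I \<Longrightarrow> z Q \<le> (\<Sum>v\<in>U. w v * D v Q)"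
      using z(1) unfolding S_def bmatching_sum_def by blast
    obtain E where E: "\<And>v. v \<in> U \<Longrightarrow> E v \<in> bmatchings I T (b v)"
      "\<And>Q. Q \<in> I \<Longrightarrow> 0 \<le> z' Q" "\<And>Q. Q \<in> I \<Longrightarrow> z' Q \<le> (\<Sum>v\<in>U. w v * E v Q)"
      using z(2) unfolding S_def bmatching_sum_def by blast
    define F where "F v = (\<lambda>Q. (1 - t) * D v Q + t * E v Q)" for v
    have F: "F v \<in> bmatchings I T (b v)" if "v \<in> U" for v
      unfolding F_def using D(1) E(1) that t by (intro bmatchings_convex)
    have "(1 - t) * z Q + t * z' Q \<le> (\<Sum>v\<in>U. w v * F v Q)" if Q: "Q \<in> I" for Q
    proof -
      have "(1 - t) * z Q + t * z' Q \<le> (1 - t) * (\<Sum>v\<in>U. w v * D v Q) + t * (\<Sum>v\<in>U. w v * E v Q)"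
        using D(3)[OF Q] E(3)[OF Q] t by (intro add_mono mult_left_mono) auto
      also have "\<dots> = (\<Sum>v\<in>U. w v * F v Q)"
        unfolding F_def sum_distrib_left sum.distrib[symmetric]
        by (intro sum.cong) (simp_all add: algebra_simps)
      finally show ?thesis .
    qed
    moreover have "0 \<le> (1 - t) * z Q + t * z' Q" if "Q \<in> I" for Q
      using D(2) E(2) that t by simp
    ultimately show "(\<lambda>Q. (1 - t) * z Q + t * z' Q) \<in> S"
      unfolding S_def bmatching_sum_def using F by blast
  next
    fix z Q assume z: "z \<in> S" and Q: "Q \<in> I"
    obtain D where D: "\<And>v. v \<in> U \<Longrightarrow> D v \<in> bmatchings I T (b v)"
      "0 \<le> z Q" "z Q \<le> (\<Sum>v\<in>U. w v * D v Q)"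
      using z Q unfolding S_def bmatching_sum_def by blast
    note D(3)
    also have "(\<Sum>v\<in>U. w v * D v Q) \<le> M Q"
      unfolding M_def using D(1) Q w by (intro sum_mono mult_left_mono bmatching_le_edge_bound)
    also have "M Q \<le> sum M I" using M0 Q finite_I by (intro member_le_sum) auto
    finally show "0 \<le> z Q \<and> z Q \<le> sum M I" using D(2) by simp
  next
    fix \<delta> :: "'a set \<Rightarrow> real" and \<zeta> :: real
    assume \<delta>: "\<And>Q. 0 \<le> \<delta> Q" and \<zeta>: "0 < \<zeta>"
    \<comment> \<open>Errors \<open>\<zeta> / (W + 1)\<close> in the single support values have a
      weighted total below \<zeta>, also when \<open>W = 0\<close>.\<close>
    define W where "W = sum w U"
    have W: "0 \<le> W" using w by (simp add: W_def sum_nonneg)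
    have "\<forall>v\<in>U. \<exists>d. d \<in> bmatchings I T (b v) \<and>
        matching_value I T (b v) \<delta> - \<zeta> / (W + 1) < (\<Sum>Q\<in>I. \<delta> Q * d Q)"
    proof
      fix v assume "v \<in> U"
      then show "\<exists>d. d \<in> bmatchings I T (b v) \<and>
        matching_value I T (b v) \<delta> - \<zeta> / (W + 1) < (\<Sum>Q\<in>I. \<delta> Q * d Q)"
        using matching_value_approx[of "b v" "\<zeta> / (W + 1)" \<delta>] b \<zeta> W by auto
    qed
    then obtain D where D: "\<And>v. v \<in> U \<Longrightarrow> D v \<in> bmatchings I T (b v)"
      "\<And>v. v \<in> U \<Longrightarrow> matching_value I T (b v) \<delta> - \<zeta> / (W + 1) < (\<Sum>Q\<in>I. \<delta> Q * D v Q)"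
      by metis
    define z where "z Q = (\<Sum>v\<in>U. w v * D v Q)" for Q
    have "z \<in> S"
      unfolding S_def bmatching_sum_def z_def using D(1) w
      by (auto intro!: exI[of _ D] sum_nonneg simp: bmatchings_def)
    moreover have "(\<Sum>Q\<in>I. \<delta> Q * x Q) - \<zeta> < (\<Sum>Q\<in>I. \<delta> Q * z Q)"
    proof -
      have "W * (\<zeta> / (W + 1)) < \<zeta>" using W \<zeta> by (simp add: field_simps)
      then have "(\<Sum>Q\<in>I. \<delta> Q * x Q) - \<zeta> <
          (\<Sum>v\<in>U. w v * matching_value I T (b v) \<delta>) - W * (\<zeta> / (W + 1))"
        using x_le[of \<delta>, OF \<delta>] by linarith
      also have "\<dots> = (\<Sum>v\<in>U. w v * (matching_value I T (b v) \<delta> - \<zeta> / (W + 1)))"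
        unfolding W_def sum_distrib_right by (simp add: right_diff_distrib sum_subtractf)
      also have "\<dots> \<le> (\<Sum>v\<in>U. w v * (\<Sum>Q\<in>I. \<delta> Q * D v Q))"
        using less_imp_le[OF D(2)] w(1) by (intro sum_mono mult_left_mono) auto
      also have "\<dots> = (\<Sum>Q\<in>I. \<delta> Q * z Q)"
        unfolding z_def sum_distrib_left by (subst sum.swap) (simp add: mult_ac)
      finally show ?thesis .
    qed
    ultimately show "\<exists>z\<in>S. (\<Sum>Q\<in>I. \<delta> Q * x Q) - \<zeta> < (\<Sum>Q\<in>I. \<delta> Q * z Q)" by blast
  qed
  then obtain z D where z: "\<And>Q. Q \<in> I \<Longrightarrow> x Q \<le> z Q + \<eta>"
    and D: "\<And>v. v \<in> U \<Longrightarrow> D v \<in> bmatchings I T (b v)"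
      "\<And>Q. Q \<in> I \<Longrightarrow> 0 \<le> z Q" "\<And>Q. Q \<in> I \<Longrightarrow> z Q \<le> (\<Sum>v\<in>U. w v * D v Q)"
    unfolding S_def bmatching_sum_def by blast
  \<comment> \<open>The mixture weights the b-matchings \<open>D v\<close> by \<open>1 / q\<close>
    and the padding by \<open>(q - 1) / q\<close>, as the bound on \<open>x Q / q\<close>
    demands.\<close>
  define t where "t = 1 - 1 / q"
  have t: "0 \<le> t" "t \<le> 1" using q by (auto simp: t_def)
  define F where "F v = (\<lambda>Q. (1 - t) * D v Q + t * (edge_bound (b v) Q / card I))" for v
  have F: "F v \<in> bmatchings I T (b v)" if "v \<in> U" for v
    unfolding F_def using D(1) that t b by (intro bmatchings_convex uniform_bmatching) auto
  have "x Q / q \<le> (\<Sum>v\<in>U. w v * F v Q)" if Q: "Q \<in> I" for Q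
  proof -
    have "x Q \<le> z Q + (q - 1) * M Q / card I"
    proof (cases "0 < M Q")
      case True
      then show ?thesis using z[OF Q] \<eta>[OF Q] by linarith
    next
      case False
      then have "M Q = 0" using M0[OF Q] by simp
      then show ?thesis using x_le_M[OF Q] D(2)[OF Q] by simp
    qed
    also have "\<dots> \<le> (\<Sum>v\<in>U. w v * D v Q) + (q - 1) * M Q / card I" using D(3)[OF Q] by simp
    finally have "x Q / q \<le> ((\<Sum>v\<in>U. w v * D v Q) + (q - 1) * M Q / card I) / q"
      using q by (intro divide_right_mono) auto
    also have "\<dots> = (1 - t) * (\<Sum>v\<in>U. w v * D v Q) + t * (M Q / card I)"
      using q by (simp add: t_def add_divide_distrib diff_divide_distrib algebra_simps)
    also have "\<dots> = (\<Sum>v\<in>U. w v * F v Q)"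
      unfolding F_def M_def sum_distrib_left sum_divide_distrib sum.distrib[symmetric]
      by (intro sum.cong) (simp_all add: algebra_simps)
    finally show ?thesis .
  qed
  moreover have "0 \<le> x Q / q" if "Q \<in> I" for Q using x0[OF that] q by simp
  ultimately show ?thesis unfolding bmatching_sum_def using F by blast
qed

end

end

section \<open>Sparsification\<close>

context demand_pairs
begin

text \<open>The values are compared only on the grid of the \<open>\<delta>\<close> for which each \<open>\<delta> Q * M Q\<close> is a multiple of
  \<open>1/m\<close> in \<open>[0, 1]\<close>, where \<open>M Q\<close> is the largest demand on \<open>Q\<close> alone. Rounding a normalised \<open>\<delta>\<close> down
  to the grid costs at most \<open>card I / m\<close>, while its value is at least \<open>1\<close>. Coordinates with
  \<open>M Q = 0\<close> do not matter; there the grid has the junk value \<open>0\<close>.\<close>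

lemma sparsify_matching_values:
  fixes U :: "'u set" and b :: "'u \<Rightarrow> 'a \<Rightarrow> real"
  assumes U: "finite U" and b: "\<And>v s. v \<in> U \<Longrightarrow> s \<in> T \<Longrightarrow> 0 \<le> b v s" and I: "I \<noteq> {}"
    and \<epsilon>: "0 < \<epsilon>" "\<epsilon> \<le> 1" and m: "0 < m" "card I \<le> \<epsilon> * real m"
    and N: "0 < N" "2 * real (m + 1) ^ card I \<le> exp (\<epsilon>\<^sup>2 * real N / (4 * card I))"
  shows "\<exists>w. (\<forall>v. 0 \<le> w v) \<and> card {v\<in>U. 0 < w v} \<le> N \<and>
    (\<forall>\<delta>. (\<forall>Q\<in>I. 0 \<le> \<delta> Q) \<longrightarrow>
       (1 - 3 * \<epsilon>) * (\<Sum>v\<in>U. matching_value I T (b v) \<delta>) \<le> (\<Sum>v\<in>U. w v * matching_value I T (b v) \<delta>) \<and>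
       (\<Sum>v\<in>U. w v * matching_value I T (b v) \<delta>) \<le> (1 + 3 * \<epsilon>) * (\<Sum>v\<in>U. matching_value I T (b v) \<delta>))"
proof -
  define c where "c v Q = edge_bound (b v) Q" for v Q
  define M where "M Q = (\<Sum>v\<in>U. c v Q)" for Q
  define val where "val v \<delta> = matching_value I T (b v) \<delta>" for v \<delta>
  define F where "F \<delta> = (\<Sum>v\<in>U. val v \<delta>)" for \<delta>
  have c0: "0 \<le> c v Q" if "v \<in> U" "Q \<in> I" for v Q
    unfolding c_def using edge_bound_nonneg[of "b v" Q] b that by blast
  have cM: "c v Q \<le> M Q" if "v \<in> U" "Q \<in> I" for v Q
    unfolding M_def using U c0 that by (intro member_le_sum) auto
  have M0: "0 \<le> M Q" if "Q \<in> I" for Q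
    unfolding M_def using c0 that by (intro sum_nonneg) auto
  have val_nonneg: "0 \<le> val v \<delta>" if "v \<in> U" "\<And>Q. Q \<in> I \<Longrightarrow> 0 \<le> \<delta> Q" for v \<delta>
    unfolding val_def using matching_value_nonneg[of "b v" \<delta>] b that by blast
  have val_le: "val v \<delta> \<le> (\<Sum>Q\<in>I. \<delta> Q * c v Q)" if "v \<in> U" "\<And>Q. Q \<in> I \<Longrightarrow> 0 \<le> \<delta> Q" for v \<delta>
    unfolding val_def c_def using matching_value_le[of "b v" \<delta>] b that by blast
  have val_ge: "\<delta> Q * c v Q \<le> val v \<delta>" if "v \<in> U" "\<And>Q. Q \<in> I \<Longrightarrow> 0 \<le> \<delta> Q" "Q \<in> I" for v Q \<delta>
    unfolding val_def c_def using matching_value_ge[of "b v" \<delta> Q] b that by blast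
  have val_combine: "val v \<delta> \<le> r * val v \<delta>1 + r' * val v \<delta>2"
    if "v \<in> U" "\<And>Q. Q \<in> I \<Longrightarrow> 0 < c v Q \<Longrightarrow> \<delta> Q \<le> r * \<delta>1 Q + r' * \<delta>2 Q"
      "0 \<le> r" "0 \<le> r'" "\<And>Q. Q \<in> I \<Longrightarrow> 0 \<le> \<delta>1 Q" "\<And>Q. Q \<in> I \<Longrightarrow> 0 \<le> \<delta>2 Q" for v \<delta> r r' \<delta>1 \<delta>2
    unfolding val_def
    by (rule matching_value_combine) (use b that in \<open>auto simp: c_def\<close>)
  have F_ge: "\<delta> Q * M Q \<le> F \<delta>" if "\<And>Q. Q \<in> I \<Longrightarrow> 0 \<le> \<delta> Q" "Q \<in> I" for Q \<delta>
    unfolding F_def M_def sum_distrib_left using val_ge that by (intro sum_mono) auto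
  define J where "J = (\<Pi>\<^sub>E Q\<in>I. {0..m})"
  have finJ: "finite J" unfolding J_def using finite_I by (intro finite_PiE) auto
  have cardJ: "card J = (m + 1) ^ card I"
    unfolding J_def using finite_I by (simp add: card_PiE)
  define u where "u j Q = real (j Q) / (real m * M Q)" for j :: "'a set \<Rightarrow> nat" and Q
  have u0: "0 \<le> u j Q" if "Q \<in> I" for j Q using M0[OF that] by (simp add: u_def)
  define s where "s v = (\<Sum>Q\<in>I. c v Q / M Q)" for v
  have s_sum: "sum s U \<le> card I"
  proof -
    have "sum s U = (\<Sum>Q\<in>I. M Q / M Q)"
      unfolding s_def M_def sum_divide_distrib by (rule sum.swap)
    also have "\<dots> \<le> (\<Sum>Q\<in>I. 1)" by (intro sum_mono) simp
    finally show ?thesis by simp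
  qed
  have s0: "0 \<le> s v" if "v \<in> U" for v
    unfolding s_def using c0 M0 that by (intro sum_nonneg) auto
  have sens: "val v \<delta> \<le> s v * F \<delta>" if v: "v \<in> U" and \<delta>: "\<And>Q. Q \<in> I \<Longrightarrow> 0 \<le> \<delta> Q" for v \<delta>
  proof -
    have "\<delta> Q * c v Q \<le> c v Q / M Q * F \<delta>" if Q: "Q \<in> I" for Q
    proof (cases "M Q = 0")
      case True
      then show ?thesis using c0[OF v Q] cM[OF v Q] by simp
    next
      case False
      then have "\<delta> Q * c v Q = c v Q / M Q * (\<delta> Q * M Q)" by simp
      also have "\<dots> \<le> c v Q / M Q * F \<delta>"
        using F_ge[of \<delta>, OF \<delta> Q] c0[OF v Q] M0[OF Q] by (intro mult_left_mono) auto
      finally show ?thesis .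
    qed
    then have "(\<Sum>Q\<in>I. \<delta> Q * c v Q) \<le> s v * F \<delta>"
      unfolding s_def sum_distrib_right by (rule sum_mono)
    then show ?thesis using val_le[of v \<delta>, OF v \<delta>] by linarith
  qed
  have "\<exists>w. (\<forall>v. 0 \<le> w v) \<and> card {v\<in>U. 0 < w v} \<le> N \<and>
      (\<forall>j\<in>J. \<bar>(\<Sum>v\<in>U. w v * val v (u j)) - (\<Sum>v\<in>U. val v (u j))\<bar> \<le> \<epsilon> * (\<Sum>v\<in>U. val v (u j)))"
  proof (rule sensitivity_sampling[OF U finJ _ s_sum _ _ \<epsilon> N(1)])
    show "2 * real (card J) \<le> exp (\<epsilon>\<^sup>2 * real N / (4 * real (card I)))"
      using N(2) by (simp add: cardJ)
    show "val v (u j) \<le> s v * (\<Sum>v\<in>U. val v (u j))" if "v \<in> U" for j v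
      using sens[of v "u j", OF that] u0 by (simp add: F_def)
  qed (use s0 val_nonneg u0 in auto)
  then obtain w where w: "\<forall>v. 0 \<le> w v" "card {v\<in>U. 0 < w v} \<le> N"
    and dev: "\<And>j. j \<in> J \<Longrightarrow> \<bar>(\<Sum>v\<in>U. w v * val v (u j)) - F (u j)\<bar> \<le> \<epsilon> * F (u j)"
    unfolding F_def by blast
  define G where "G \<delta> = (\<Sum>v\<in>U. w v * val v \<delta>)" for \<delta>
  have upper: "G (u j) \<le> (1 + \<epsilon>) * F (u j)" and lower: "(1 - \<epsilon>) * F (u j) \<le> G (u j)"
    if "j \<in> J" for j
    using dev[OF that] unfolding G_def by (auto simp: abs_le_iff algebra_simps)
  \<comment> \<open>The direction with \<open>\<delta> Q * M Q = 1\<close> wherever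
    \<open>M Q\<close> is positive. A multiple of it dominates the rounding error, and its total
    value is at most \<open>card I\<close>.\<close>
  define top where "top = restrict (\<lambda>_. m) I"
  have topJ: "top \<in> J" by (auto simp: top_def J_def)
  have F_top: "F (u top) \<le> card I"
  proof -
    have "F (u top) \<le> (\<Sum>v\<in>U. \<Sum>Q\<in>I. u top Q * c v Q)"
      unfolding F_def using val_le[of _ "u top"] u0 by (intro sum_mono) auto
    also have "\<dots> = (\<Sum>Q\<in>I. u top Q * M Q)"
      unfolding M_def sum_distrib_left by (rule sum.swap)
    also have "\<dots> \<le> (\<Sum>Q\<in>I. 1)"
      using m(1) by (intro sum_mono) (simp add: u_def top_def)
    finally show ?thesis by simp
  qed
  have "(1 - 3 * \<epsilon>) * F \<delta> \<le> G \<delta> \<and> G \<delta> \<le> (1 + 3 * \<epsilon>) * F \<delta>"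
    if \<delta>: "\<And>Q. Q \<in> I \<Longrightarrow> 0 \<le> \<delta> Q" for \<delta>
  proof -
    \<comment> \<open>The scale of \<delta>: dividing by \<open>R\<close> brings all
      \<open>\<delta> Q * M Q\<close> into the range of the grid, and \<open>R\<close> is a lower
      bound on \<open>F \<delta>\<close>.\<close>
    define R where "R = Max ((\<lambda>Q. \<delta> Q * M Q) ` I)"
    have R_ge: "\<delta> Q * M Q \<le> R" if "Q \<in> I" for Q
      unfolding R_def using finite_I that by simp
    have "R \<in> (\<lambda>Q. \<delta> Q * M Q) ` I"
      unfolding R_def using finite_I I by (intro Max_in) auto
    then obtain Q0 where Q0: "Q0 \<in> I" "R = \<delta> Q0 * M Q0" by blast
    have R0: "0 \<le> R" using \<delta>[OF Q0(1)] M0[OF Q0(1)] Q0(2) by simp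
    have RF: "R \<le> F \<delta>" using F_ge[of \<delta>, OF \<delta> Q0(1)] Q0(2) by simp
    show ?thesis
    proof (cases "R = 0")
      case True
      \<comment> \<open>Here \<delta> vanishes on every pair that a star can use, so no rescaling is
        possible and all values are 0.\<close>
      have "val v \<delta> = 0" if v: "v \<in> U" for v
      proof -
        have "\<delta> Q * c v Q \<le> 0" if Q: "Q \<in> I" for Q
          using mult_left_mono[OF cM[OF v Q] \<delta>[OF Q]] R_ge[OF Q] True by simp
        then have "(\<Sum>Q\<in>I. \<delta> Q * c v Q) \<le> 0" by (intro sum_nonpos) auto
        then show ?thesis using val_le[of v \<delta>, OF v \<delta>] val_nonneg[of v \<delta>, OF v \<delta>] by simp
      qed
      then show ?thesis by (simp add: F_def G_def)
    next
      case False
      then have Rpos: "0 < R" using R0 by simp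
      define j where "j = (\<lambda>Q\<in>I. nat \<lfloor>real m * (\<delta> Q * M Q) / R\<rfloor>)"
      have j: "real (j Q) \<le> real m * (\<delta> Q * M Q) / R" "real m * (\<delta> Q * M Q) / R \<le> real (j Q) + 1"
        if Q: "Q \<in> I" for Q
      proof -
        have nn: "0 \<le> real m * (\<delta> Q * M Q) / R" using \<delta>[OF Q] M0[OF Q] R0 by simp
        have "real (j Q) = of_int \<lfloor>real m * (\<delta> Q * M Q) / R\<rfloor>"
          using Q nn by (simp add: j_def)
        then show "real (j Q) \<le> real m * (\<delta> Q * M Q) / R" "real m * (\<delta> Q * M Q) / R \<le> real (j Q) + 1"
          by linarith+
      qed
      have jJ: "j \<in> J"
      proof -
        have "j Q \<le> m" if Q: "Q \<in> I" for Q
        proof -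
          have "real m * (\<delta> Q * M Q) \<le> real m * R" using R_ge[OF Q] by (intro mult_left_mono) auto
          then have "real m * (\<delta> Q * M Q) / R \<le> real m" using Rpos by (simp add: divide_le_eq)
          then show ?thesis using j(1)[OF Q] by linarith
        qed
        then show ?thesis by (auto simp: J_def j_def)
      qed
      have below: "R * u j Q \<le> \<delta> Q" if Q: "Q \<in> I" for Q
      proof (cases "M Q = 0")
        case True
        then show ?thesis using \<delta>[OF Q] by (simp add: u_def)
      next
        case False
        then have "0 < M Q" using M0[OF Q] by simp
        then show ?thesis using j(1)[OF Q] Rpos m(1) by (simp add: u_def field_simps)
      qed
      \<comment> \<open>Rounding down loses at most one grid step, and
        \<open>R / m * u top Q\<close> is one step in the scale of \<delta>.\<close>
      have above: "\<delta> Q \<le> R * u j Q + R / m * u top Q" if Q: "Q \<in> I" and MQ: "0 < M Q" for Q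
      proof -
        have "\<delta> Q = R / (m * M Q) * (real m * (\<delta> Q * M Q) / R)"
          using Rpos m(1) MQ by simp
        also have "\<dots> \<le> R / (m * M Q) * (real (j Q) + 1)"
          using j(2)[OF Q] Rpos m(1) MQ by (intro mult_left_mono) auto
        also have "\<dots> = R * u j Q + R / m * u top Q"
          using m(1) Q by (simp add: u_def top_def add_divide_distrib algebra_simps)
        finally show ?thesis .
      qed
      have val_above: "val v \<delta> \<le> R * val v (u j) + R / m * val v (u top)" if v: "v \<in> U" for v
        using v R0 u0 cM[OF v] by (intro val_combine above) (auto intro: less_le_trans)
      have val_below: "R * val v (u j) \<le> val v \<delta>" if v: "v \<in> U" for v
      proof -
        have "val v (u j) \<le> 1 / R * val v \<delta> + 0 * val v \<delta>"
          using below Rpos \<delta> by (intro val_combine[OF v]) (auto simp: field_simps)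
        then show ?thesis using Rpos by (simp add: field_simps)
      qed
      have F_above: "F \<delta> \<le> R * F (u j) + R / m * F (u top)"
      proof -
        have "F \<delta> \<le> (\<Sum>v\<in>U. R * val v (u j) + R / m * val v (u top))"
          unfolding F_def by (intro sum_mono val_above)
        then show ?thesis unfolding F_def sum_distrib_left sum.distrib .
      qed
      have G_above: "G \<delta> \<le> R * G (u j) + R / m * G (u top)"
      proof -
        have "G \<delta> \<le> (\<Sum>v\<in>U. w v * (R * val v (u j) + R / m * val v (u top)))"
          unfolding G_def using w(1) by (intro sum_mono mult_left_mono val_above) auto
        also have "\<dots> = R * G (u j) + R / m * G (u top)"
          unfolding G_def sum_distrib_left sum.distrib[symmetric]
          by (intro sum.cong) (auto simp: algebra_simps)
        finally show ?thesis .
      qed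
      have F_below: "R * F (u j) \<le> F \<delta>"
        unfolding F_def sum_distrib_left by (intro sum_mono val_below)
      have G_below: "R * G (u j) \<le> G \<delta>"
      proof -
        have "R * G (u j) = (\<Sum>v\<in>U. w v * (R * val v (u j)))"
          unfolding G_def sum_distrib_left by (simp add: mult_ac)
        also have "\<dots> \<le> G \<delta>"
          unfolding G_def using w(1) by (intro sum_mono mult_left_mono val_below) auto
        finally show ?thesis .
      qed
      have F0: "0 \<le> F \<delta>" using R0 RF by simp
      have round: "R / m * F (u top) \<le> \<epsilon> * F \<delta>"
      proof -
        have "R / m * F (u top) \<le> R / m * (\<epsilon> * m)"
          using F_top m R0 by (intro mult_left_mono) auto
        also have "\<dots> = \<epsilon> * R" using m(1) by simp
        also have "\<dots> \<le> \<epsilon> * F \<delta>" using RF \<epsilon> by (intro mult_left_mono) auto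
        finally show ?thesis .
      qed
      \<comment> \<open>The sampled sum is controlled at both grid points, \<open>u j\<close> and
        \<open>u top\<close>. Rounding and sampling each cost \<open>1 + \<epsilon>\<close>, and
        \<open>(1 + \<epsilon>)\<^sup>2 \<le> 1 + 3 * \<epsilon>\<close> since
        \<open>\<epsilon> \<le> 1\<close>.\<close>
      have "G \<delta> \<le> R * ((1 + \<epsilon>) * F (u j)) + R / m * ((1 + \<epsilon>) * F (u top))"
        using G_above upper[OF jJ] upper[OF topJ] R0
        by (elim order_trans) (intro add_mono mult_left_mono; simp)
      also have "\<dots> = (1 + \<epsilon>) * (R * F (u j) + R / m * F (u top))"
        using m(1) by (simp add: field_simps)
      also have "\<dots> \<le> (1 + \<epsilon>) * (F \<delta> + \<epsilon> * F \<delta>)"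
        using F_below round \<epsilon> by (intro mult_left_mono) auto
      also have "\<dots> = (1 + (2 * \<epsilon> + \<epsilon> * \<epsilon>)) * F \<delta>" by (simp add: algebra_simps)
      also have "\<dots> \<le> (1 + 3 * \<epsilon>) * F \<delta>"
        using F0 \<epsilon> mult_left_mono[of \<epsilon> 1 \<epsilon>] by (intro mult_right_mono) auto
      finally have 1: "G \<delta> \<le> (1 + 3 * \<epsilon>) * F \<delta>" .
      have "(1 - 3 * \<epsilon>) * F \<delta> \<le> (1 - \<epsilon>) * (F \<delta> - \<epsilon> * F \<delta>)"
      proof -
        have "(1 - \<epsilon>) * (F \<delta> - \<epsilon> * F \<delta>) = (1 - 2 * \<epsilon> + \<epsilon> * \<epsilon>) * F \<delta>" by (simp add: algebra_simps)
        then show ?thesis using F0 \<epsilon> by (simp add: mult_right_mono)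
      qed
      also have "\<dots> \<le> (1 - \<epsilon>) * (R * F (u j))"
        using F_above round \<epsilon> by (intro mult_left_mono) auto
      also have "\<dots> = R * ((1 - \<epsilon>) * F (u j))" by simp
      also have "\<dots> \<le> R * G (u j)" using lower[OF jJ] R0 by (intro mult_left_mono)
      also note G_below
      finally show ?thesis using 1 by simp
    qed
  qed
  then show ?thesis using w unfolding F_def G_def val_def by blast
qed

text \<open>Sampling with accuracy \<open>\<epsilon> / 24\<close> makes the support functions agree
  up to \<open>\<epsilon> / 8\<close>, by the factor 3 in \<open>sparsify_matching_values\<close>.
  Each inclusion then loses a factor \<open>q\<close>, and
  \<open>q ^ 3 / r \<le> 1 + \<epsilon>\<close> collects all losses.\<close>

lemma sparsify_bmatching_sum:
  fixes U :: "'u set" and b :: "'u \<Rightarrow> 'a \<Rightarrow> real"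
  assumes U: "finite U" and b: "\<And>v s. v \<in> U \<Longrightarrow> s \<in> T \<Longrightarrow> 0 \<le> b v s" and I: "I \<noteq> {}"
    and \<epsilon>: "0 < \<epsilon>" "\<epsilon> \<le> 1" and m: "0 < m" "card I \<le> \<epsilon> / 24 * real m"
    and N: "0 < N" "2 * real (m + 1) ^ card I \<le> exp ((\<epsilon> / 24)\<^sup>2 * real N / (4 * card I))"
  shows "\<exists>w. (\<forall>v. 0 \<le> w v) \<and> card {v\<in>U. 0 < w v} \<le> N \<and>
    bmatching_sum I T U b (\<lambda>_. 1) \<subseteq> bmatching_sum I T U b w \<and>
    (\<forall>x\<in>bmatching_sum I T U b w. (\<lambda>Q. x Q / (1 + \<epsilon>)) \<in> bmatching_sum I T U b (\<lambda>_. 1))"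
proof -
  define F where "F w \<delta> = (\<Sum>v\<in>U. w v * matching_value I T (b v) \<delta>)" for w \<delta>
  have F0: "0 \<le> F (\<lambda>_. 1) \<delta>" if "\<forall>Q\<in>I. 0 \<le> \<delta> Q" for \<delta>
    unfolding F_def using matching_value_nonneg[of "b _" \<delta>] b that by (auto intro!: sum_nonneg)
  have "\<exists>w. (\<forall>v. 0 \<le> w v) \<and> card {v\<in>U. 0 < w v} \<le> N \<and>
    (\<forall>\<delta>. (\<forall>Q\<in>I. 0 \<le> \<delta> Q) \<longrightarrow> (1 - \<epsilon> / 8) * F (\<lambda>_. 1) \<delta> \<le> F w \<delta> \<and> F w \<delta> \<le> (1 + \<epsilon> / 8) * F (\<lambda>_. 1) \<delta>)"
    using sparsify_matching_values[of U b "\<epsilon> / 24" m N] U b I \<epsilon> m N by (simp add: F_def)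
  then obtain w where w: "\<And>v. 0 \<le> w v" "card {v\<in>U. 0 < w v} \<le> N"
    and wF: "\<And>\<delta>. \<forall>Q\<in>I. 0 \<le> \<delta> Q \<Longrightarrow> (1 - \<epsilon> / 8) * F (\<lambda>_. 1) \<delta> \<le> F w \<delta>"
      "\<And>\<delta>. \<forall>Q\<in>I. 0 \<le> \<delta> Q \<Longrightarrow> F w \<delta> \<le> (1 + \<epsilon> / 8) * F (\<lambda>_. 1) \<delta>"
    by blast
  \<comment> \<open>\<open>q\<close> serves both as the upper sampling error and as the factor given
    up in \<open>bmatching_sum_subset\<close>; \<open>r\<close> is the lower sampling error.\<close>
  define q where "q = 1 + \<epsilon> / 8"
  define r where "r = 1 - \<epsilon> / 8"
  have qr: "1 < q" "0 < r" using \<epsilon> by (auto simp: q_def r_def)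
  have F_scale: "F (\<lambda>v. a * w v) \<delta> = a * F w \<delta>" for a w \<delta>
    by (simp add: F_def sum_distrib_left mult.assoc)
  \<comment> \<open>Dividing by \<open>r\<close> makes the sampled support function dominate the
    original; the extra factor \<open>q\<close> in \<open>w2\<close> pays for the loss in
    \<open>bmatching_sum_subset\<close>.\<close>
  define w1 where "w1 v = 1 / r * w v" for v
  define w2 where "w2 v = q / r * w v" for v
  have w12: "0 \<le> w1 v" "0 \<le> w2 v" for v using w(1)[of v] qr by (auto simp: w1_def w2_def)
  have incl: "x \<in> bmatching_sum I T U b w2" if x: "x \<in> bmatching_sum I T U b (\<lambda>_. 1)" for x
  proof -
    have "(\<lambda>Q. x Q / q) \<in> bmatching_sum I T U b w1"
    proof (rule bmatching_sum_subset[OF U, of b w1 "\<lambda>_. 1" q x])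
      fix \<delta> :: "'a set \<Rightarrow> real" assume "\<And>Q. Q \<in> I \<Longrightarrow> 0 \<le> \<delta> Q"
      then have "r * F (\<lambda>_. 1) \<delta> \<le> F w \<delta>" using wF(1)[of \<delta>] by (simp add: r_def)
      then have "F (\<lambda>_. 1) \<delta> \<le> F w1 \<delta>"
        unfolding w1_def F_scale using qr by (simp add: field_simps)
      then show "(\<Sum>v\<in>U. 1 * matching_value I T (b v) \<delta>) \<le> (\<Sum>v\<in>U. w1 v * matching_value I T (b v) \<delta>)"
        unfolding F_def .
    qed (use b w12 qr x in auto)
    then show ?thesis
      by (rule bmatching_sum_scale[where r = q])
        (use x qr in \<open>auto simp: w1_def w2_def bmatching_sum_def\<close>)
  qed
  have outer: "(\<lambda>Q. x Q / (1 + \<epsilon>)) \<in> bmatching_sum I T U b (\<lambda>_. 1)"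
    if x: "x \<in> bmatching_sum I T U b w2" for x
  proof -
    define a where "a = q * q / r"
    have a: "0 < a" using qr by (simp add: a_def)
    have "(\<lambda>Q. x Q / q) \<in> bmatching_sum I T U b (\<lambda>_. a)"
    proof (rule bmatching_sum_subset[OF U, of b "\<lambda>_. a" w2 q x])
      fix \<delta> :: "'a set \<Rightarrow> real" assume "\<And>Q. Q \<in> I \<Longrightarrow> 0 \<le> \<delta> Q"
      then have "F w \<delta> \<le> q * F (\<lambda>_. 1) \<delta>" using wF(2)[of \<delta>] by (simp add: q_def)
      then have "q / r * F w \<delta> \<le> q / r * (q * F (\<lambda>_. 1) \<delta>)" using qr by (intro mult_left_mono) auto
      moreover have "F (\<lambda>_. a) \<delta> = a * F (\<lambda>_. 1) \<delta>" using F_scale[of a "\<lambda>_. 1" \<delta>] by simp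
      ultimately have "F w2 \<delta> \<le> F (\<lambda>_. a) \<delta>" unfolding w2_def F_scale by (simp add: a_def)
      then show "(\<Sum>v\<in>U. w2 v * matching_value I T (b v) \<delta>) \<le> (\<Sum>v\<in>U. a * matching_value I T (b v) \<delta>)"
        unfolding F_def .
    qed (use b w12 qr x a in auto)
    moreover have "1 / (1 + \<epsilon>) \<le> 1 / a * (1 / q)"
    proof -
      have "q * q * q \<le> (1 + \<epsilon>) * r"
      proof -
        have "\<epsilon>\<^sup>2 \<le> \<epsilon>" "\<epsilon>^3 \<le> \<epsilon>"
          using \<epsilon> power_decreasing[of 1 2 \<epsilon>] power_decreasing[of 1 3 \<epsilon>] by auto
        moreover have "(1 + \<epsilon>) * r - q * q * q = \<epsilon> / 2 - 11 / 64 * \<epsilon>\<^sup>2 - \<epsilon>^3 / 512"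
          by (simp add: q_def r_def field_simps power2_eq_square power3_eq_cube)
        ultimately show ?thesis using \<epsilon> by linarith
      qed
      then show ?thesis using qr \<epsilon> by (simp add: a_def field_simps)
    qed
    then have "x Q / (1 + \<epsilon>) \<le> 1 / a * (x Q / q)" if "Q \<in> I" for Q
      using x that mult_left_mono[of "1 / (1 + \<epsilon>)" "1 / a * (1 / q)" "x Q"]
      by (simp add: bmatching_sum_def)
    ultimately show ?thesis
      by (elim bmatching_sum_scale[where r = "1 / a"])
        (use x a \<epsilon> in \<open>auto simp: bmatching_sum_def\<close>)
  qed
  have "{v\<in>U. 0 < w2 v} = {v\<in>U. 0 < w v}" using qr by (auto simp: w2_def zero_less_mult_iff zero_less_divide_iff)
  then have "card {v\<in>U. 0 < w2 v} \<le> N" using w(2) by simp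
  then show ?thesis using w12(2) incl outer by blast
qed

end

section \<open>Routing through the stars\<close>

text \<open>\<open>cap\<close> is arbitrary off the edge set. Reading it as 0 there makes every
  non-terminal the centre of a star over all of \<open>T\<close>.\<close>

definition ext_cap :: "'v network \<Rightarrow> 'v set \<Rightarrow> real" where
  "ext_cap H e = (if e \<in> edges H then cap H e else 0)"

definition terminal_clique :: "'v set \<Rightarrow> ('v set \<Rightarrow> real) \<Rightarrow> 'v network" where
  "terminal_clique T a = \<lparr>verts = T, edges = nsets T 2, cap = a\<rparr>"

lemma sum_pairs_at:
  assumes "finite T" "s \<in> T"
  shows "(\<Sum>Q | Q \<in> nsets T 2 \<and> s \<in> Q. h Q) = (\<Sum>t\<in>T - {s}. h {s, t})"
proof -
  have "{Q. Q \<in> nsets T 2 \<and> s \<in> Q} = (\<lambda>t. {s, t}) ` (T - {s})"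
    using assms by (auto simp: nsets_def card_2_iff doubleton_eq_iff)
  moreover have "inj_on (\<lambda>t. {s, t}) (T - {s})"
    by (auto simp: inj_on_def doubleton_eq_iff)
  ultimately show ?thesis by (simp add: sum.reindex)
qed

lemma st_flowD:
  assumes "st_flow H s t x g"
  shows "0 \<le> g u v" "{u, v} \<notin> edges H \<Longrightarrow> g u v = 0"
    "v \<in> verts H - {s, t} \<Longrightarrow> (\<Sum>u\<in>verts H. g v u) = (\<Sum>u\<in>verts H. g u v)"
    "(\<Sum>u\<in>verts H. g s u) - (\<Sum>u\<in>verts H. g u s) = x"
  using assms unfolding st_flow_def by blast+

locale terminals =
  fixes H :: "'v network" and T :: "'v set"
  assumes network: "terminal_network H T"
begin

definition U :: "'v set" where "U = verts H - T"

lemma finite_T: "finite T" and finite_U: "finite U" and verts: "verts H = T \<union> U" "T \<inter> U = {}"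
  using network finite_subset[of T "verts H"] by (auto simp: terminal_network_def U_def)

lemma sum_verts: "sum h (verts H) = sum h T + sum h U"
  using finite_T finite_U verts by (simp add: sum.union_disjoint)

lemma finite_pairs: "finite (nsets T 2)"
  using finite_T by (simp add: finite_imp_finite_nsets)

lemma edge: "{u, v} \<in> edges H \<Longrightarrow> u \<in> verts H \<and> v \<in> verts H \<and> u \<noteq> v"
  using network unfolding terminal_network_def by (metis doubleton_in_nsets_2 subsetD)

lemma ext_cap_nonneg: "0 \<le> ext_cap H e"
  using network by (simp add: ext_cap_def terminal_network_def)

text \<open>At a non-terminal \<open>v\<close> each commodity is split into flows from \<open>s\<close> to \<open>t\<close> through \<open>v\<close> in
  proportion to the inflow from \<open>s\<close> and the outflow to \<open>t\<close>. Flow returning to the terminal it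
  came from (\<open>s = t\<close>) is dropped.\<close>

lemma routable_clique_of_routable:
  assumes quasi: "quasi_bipartite H T" and r: "routable H T d"
  shows "\<exists>D. (\<forall>v\<in>U. D v \<in> bmatchings (nsets T 2) T (\<lambda>s. ext_cap H {v, s})) \<and>
     routable (terminal_clique T (\<lambda>Q. ext_cap H Q + (\<Sum>v\<in>U. D v Q))) T d"
proof -
  let ?I = "nsets T 2"
  obtain f where f_all: "\<forall>P\<in>?I. \<exists>s t. P = {s, t} \<and> st_flow H s t (d P) (f P)"
    and load_all: "\<forall>u v. {u, v} \<in> edges H \<longrightarrow> (\<Sum>P\<in>?I. f P u v + f P v u) \<le> cap H {u, v}"
    using r unfolding routable_def by blast
  have f: "\<exists>s t. P = {s, t} \<and> st_flow H s t (d P) (f P)" if "P \<in> ?I" for P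
    using f_all that by (rule bspec)
  have load: "(\<Sum>P\<in>?I. f P u v + f P v u) \<le> cap H {u, v}" if "{u, v} \<in> edges H" for u v
    using load_all that by simp
  have f0: "0 \<le> f P u v" if "P \<in> ?I" for P u v using f[OF that] by (metis st_flowD(1))
  have fe: "f P u v = 0" if "P \<in> ?I" "{u, v} \<notin> edges H" for P u v
    using f[OF that(1)] that(2) by (metis st_flowD(2))
  have loop: "f P u u = 0" if "P \<in> ?I" for P u
    using fe[OF that] edge by blast
  \<comment> \<open>Quasi-bipartiteness enters here: flow at a non-terminal is exchanged with
    terminals only, so conservation balances inflow from \<open>T\<close> and outflow to
    \<open>T\<close>.\<close>
  have UU: "f P u v = 0" if "P \<in> ?I" "u \<in> U" "v \<in> U" for P u v
    using fe that quasi unfolding quasi_bipartite_def U_def by blast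
  have load': "(\<Sum>P\<in>?I. f P u v + f P v u) \<le> ext_cap H {u, v}" for u v
  proof (cases "{u, v} \<in> edges H")
    case False
    then have "f P u v = 0 \<and> f P v u = 0" if "P \<in> ?I" for P
      using fe that by (metis insert_commute)
    then show ?thesis using False by (simp add: ext_cap_def)
  qed (use load in \<open>simp add: ext_cap_def\<close>)
  define infl where "infl P v = (\<Sum>u\<in>T. f P u v)" for P v
  have bal: "infl P v = (\<Sum>u\<in>T. f P v u)" if P: "P \<in> ?I" and v: "v \<in> U" for P v
  proof -
    obtain s t where st: "P = {s, t}" "st_flow H s t (d P) (f P)" using f[OF P] by blast
    then have "s \<in> T" "t \<in> T" using P by auto
    then have "v \<in> verts H - {s, t}" using v verts by auto
    then have "(\<Sum>u\<in>verts H. f P v u) = (\<Sum>u\<in>verts H. f P u v)" by (rule st_flowD(3)[OF st(2)])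
    then show ?thesis using UU[OF P] v by (simp add: sum_verts infl_def)
  qed
  have infl_zero: "f P v t = 0" "f P t v = 0"
    if "infl P v = 0" and P: "P \<in> ?I" and v: "v \<in> U" "t \<in> T" for P v t
    using that bal[OF P v(1)] f0[OF P] finite_T by (simp_all add: infl_def sum_nonneg_eq_0_iff)
  \<comment> \<open>If nothing passes through \<open>v\<close>, division by zero gives 0, in
    agreement with the vanishing flows on its edges.\<close>
  define th where "th P v s t = f P s v * f P v t / infl P v" for P v s t
  have th0: "0 \<le> th P v s t" if "P \<in> ?I" for P v s t
    using f0[OF that] by (auto simp: th_def infl_def intro!: divide_nonneg_nonneg mult_nonneg_nonneg sum_nonneg)
  have th_out: "(\<Sum>t\<in>T. th P v s t) = f P s v" if P: "P \<in> ?I" and v: "v \<in> U" "s \<in> T" for P v s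
  proof -
    have "(\<Sum>t\<in>T. th P v s t) = f P s v * infl P v / infl P v"
      unfolding th_def bal[OF P v(1)] by (simp add: sum_distrib_left sum_divide_distrib)
    then show ?thesis using infl_zero[OF _ P v] by (cases "infl P v = 0") auto
  qed
  have th_in: "(\<Sum>s\<in>T. th P v s t) = f P v t" if P: "P \<in> ?I" and v: "v \<in> U" "t \<in> T" for P v t
  proof -
    have "(\<Sum>s\<in>T. th P v s t) = infl P v * f P v t / infl P v"
      unfolding th_def infl_def by (simp add: sum_distrib_right sum_divide_distrib)
    then show ?thesis using infl_zero[OF _ P v] by (cases "infl P v = 0") auto
  qed
  define D where "D v Q = (\<Sum>P\<in>?I. \<Sum>s\<in>Q. \<Sum>t\<in>Q - {s}. th P v s t)" for v Q
  have D: "D v {s, t} = (\<Sum>P\<in>?I. th P v s t + th P v t s)" if "s \<noteq> t" for v s t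
    unfolding D_def using that by (intro sum.cong) (auto simp: insert_Diff_if)
  define g where "g P s t = (if s \<in> T \<and> t \<in> T \<and> s \<noteq> t then f P s t + (\<Sum>v\<in>U. th P v s t) else 0)" for P s t
  \<comment> \<open>Dropping the diagonal terms \<open>th P v x x\<close> lowers outflow and inflow
    at \<open>x\<close> equally, so the net flow survives.\<close>
  have g_net: "(\<Sum>u\<in>T. g P x u) - (\<Sum>u\<in>T. g P u x) = (\<Sum>u\<in>verts H. f P x u) - (\<Sum>u\<in>verts H. f P u x)"
    if P: "P \<in> ?I" and x: "x \<in> T" for P x
  proof -
    have "(\<Sum>u\<in>T. g P x u) = (\<Sum>u\<in>T. f P x u + (\<Sum>v\<in>U. th P v x u)) - (\<Sum>v\<in>U. th P v x x)"
    proof -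
      have "(\<Sum>u\<in>T. g P x u) =
          (\<Sum>u\<in>T. f P x u + (\<Sum>v\<in>U. th P v x u) - (if u = x then \<Sum>v\<in>U. th P v x x else 0))"
        using x loop[OF P] by (intro sum.cong) (auto simp: g_def)
      then show ?thesis using finite_T x by (simp add: sum_subtractf)
    qed
    also have "(\<Sum>u\<in>T. f P x u + (\<Sum>v\<in>U. th P v x u)) = (\<Sum>u\<in>T. f P x u) + (\<Sum>v\<in>U. \<Sum>u\<in>T. th P v x u)"
      unfolding sum.distrib by (subst (2) sum.swap) simp
    also have "(\<Sum>v\<in>U. \<Sum>u\<in>T. th P v x u) = (\<Sum>v\<in>U. f P x v)"
      using th_out[OF P _ x] by (intro sum.cong) auto
    finally have 1: "(\<Sum>u\<in>T. g P x u) = (\<Sum>u\<in>verts H. f P x u) - (\<Sum>v\<in>U. th P v x x)"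
      by (simp add: sum_verts)
    have "(\<Sum>u\<in>T. g P u x) = (\<Sum>u\<in>T. f P u x + (\<Sum>v\<in>U. th P v u x)) - (\<Sum>v\<in>U. th P v x x)"
    proof -
      have "(\<Sum>u\<in>T. g P u x) =
          (\<Sum>u\<in>T. f P u x + (\<Sum>v\<in>U. th P v u x) - (if u = x then \<Sum>v\<in>U. th P v x x else 0))"
        using x loop[OF P] by (intro sum.cong) (auto simp: g_def)
      then show ?thesis using finite_T x by (simp add: sum_subtractf)
    qed
    also have "(\<Sum>u\<in>T. f P u x + (\<Sum>v\<in>U. th P v u x)) = (\<Sum>u\<in>T. f P u x) + (\<Sum>v\<in>U. \<Sum>u\<in>T. th P v u x)"
      unfolding sum.distrib by (subst (2) sum.swap) simp
    also have "(\<Sum>v\<in>U. \<Sum>u\<in>T. th P v u x) = (\<Sum>v\<in>U. f P v x)"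
      using th_in[OF P _ x] by (intro sum.cong) auto
    finally have "(\<Sum>u\<in>T. g P u x) = (\<Sum>u\<in>verts H. f P u x) - (\<Sum>v\<in>U. th P v x x)"
      by (simp add: sum_verts)
    with 1 show ?thesis by simp
  qed
  have Dm: "D v \<in> bmatchings ?I T (\<lambda>s. ext_cap H {v, s})" if v: "v \<in> U" for v
  proof -
    have "(\<Sum>Q | Q \<in> ?I \<and> s \<in> Q. D v Q) \<le> ext_cap H {v, s}" if s: "s \<in> T" for s
    proof -
      have "(\<Sum>Q | Q \<in> ?I \<and> s \<in> Q. D v Q) = (\<Sum>t\<in>T - {s}. D v {s, t})"
        by (rule sum_pairs_at[OF finite_T s])
      also have "\<dots> = (\<Sum>t\<in>T - {s}. \<Sum>P\<in>?I. th P v s t + th P v t s)"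
        using D by (intro sum.cong) auto
      also have "\<dots> = (\<Sum>P\<in>?I. \<Sum>t\<in>T - {s}. th P v s t + th P v t s)" by (rule sum.swap)
      \<comment> \<open>Readmitting \<open>t = s\<close> completes the sums to all flow between
        \<open>v\<close> and \<open>s\<close> in both directions, which the capacity bounds.\<close>
      also have "\<dots> \<le> (\<Sum>P\<in>?I. \<Sum>t\<in>T. th P v s t + th P v t s)"
        using th0 finite_T by (intro sum_mono sum_mono2) (auto intro: add_nonneg_nonneg)
      also have "\<dots> = (\<Sum>P\<in>?I. f P v s + f P s v)"
        using th_out[OF _ v s] th_in[OF _ v s] by (intro sum.cong) (auto simp: sum.distrib)
      also have "\<dots> \<le> ext_cap H {v, s}" by (rule load')
      finally show ?thesis .
    qed
    moreover have "0 \<le> D v Q" for Q unfolding D_def using th0 by (intro sum_nonneg)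
    ultimately show ?thesis unfolding bmatchings_def by blast
  qed
  let ?K = "terminal_clique T (\<lambda>Q. ext_cap H Q + (\<Sum>v\<in>U. D v Q))"
  have "\<exists>s t. P = {s, t} \<and> st_flow ?K s t (d P) (g P)" if P: "P \<in> ?I" for P
  proof -
    obtain s t where st: "P = {s, t}" "st_flow H s t (d P) (f P)" using f[OF P] by blast
    then have T: "s \<in> T" "t \<in> T" using P by auto
    have "st_flow ?K s t (d P) (g P)"
      unfolding st_flow_def
    proof (intro conjI allI ballI impI)
      show "0 \<le> g P u v" for u v using f0[OF P] th0[OF P] by (simp add: g_def sum_nonneg)
      show "g P u v = 0" if "{u, v} \<notin> edges ?K" for u v
        using that by (auto simp: terminal_clique_def g_def)
      show "(\<Sum>u\<in>verts ?K. g P v u) = (\<Sum>u\<in>verts ?K. g P u v)" if v: "v \<in> verts ?K - {s, t}" for v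
      proof -
        have "v \<in> T" "v \<in> verts H - {s, t}" using v verts by (auto simp: terminal_clique_def)
        then show ?thesis using g_net[OF P, of v] st_flowD(3)[OF st(2), of v] by (simp add: terminal_clique_def)
      qed
      show "(\<Sum>u\<in>verts ?K. g P s u) - (\<Sum>u\<in>verts ?K. g P u s) = d P"
        using g_net[OF P T(1)] st_flowD(4)[OF st(2)] by (simp add: terminal_clique_def)
    qed
    then show ?thesis using st(1) by blast
  qed
  moreover have "(\<Sum>P\<in>?I. g P u v + g P v u) \<le> cap ?K {u, v}" if "{u, v} \<in> edges ?K" for u v
  proof -
    have uv: "u \<in> T" "v \<in> T" "u \<noteq> v" using that by (auto simp: terminal_clique_def)
    have "(\<Sum>P\<in>?I. g P u v + g P v u) =
        (\<Sum>P\<in>?I. f P u v + f P v u) + (\<Sum>P\<in>?I. \<Sum>w\<in>U. th P w u v + th P w v u)"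
      using uv by (simp add: g_def sum.distrib)
    also have "(\<Sum>P\<in>?I. \<Sum>w\<in>U. th P w u v + th P w v u) = (\<Sum>w\<in>U. D w {u, v})"
      unfolding D[OF uv(3)] by (rule sum.swap)
    finally show ?thesis using load'[of u v] by (simp add: terminal_clique_def)
  qed
  ultimately have "routable ?K T d" unfolding routable_def by blast
  then show ?thesis using Dm by blast
qed

text \<open>The clique flow on each pair is divided in proportion to the capacities that add up
  there: the direct share stays on the edge, the share of \<open>v\<close> takes the detour through
  \<open>v\<close>. The load between \<open>v\<close> and \<open>s\<close> is then at most the
  degree of \<open>s\<close> in \<open>D v\<close>.\<close>

lemma routable_of_routable_clique:
  assumes Dm: "\<And>v. v \<in> U \<Longrightarrow> D v \<in> bmatchings (nsets T 2) T (\<lambda>s. ext_cap H {v, s})"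
    and r: "routable (terminal_clique T (\<lambda>Q. ext_cap H Q + (\<Sum>v\<in>U. D v Q))) T d"
  shows "routable H T d"
proof -
  let ?I = "nsets T 2"
  define a where "a Q = ext_cap H Q + (\<Sum>v\<in>U. D v Q)" for Q
  let ?K = "terminal_clique T a"
  have "routable ?K T d" using r unfolding a_def .
  then obtain g where g_all: "\<forall>P\<in>?I. \<exists>s t. P = {s, t} \<and> st_flow ?K s t (d P) (g P)"
    and load_all: "\<forall>u v. {u, v} \<in> edges ?K \<longrightarrow> (\<Sum>P\<in>?I. g P u v + g P v u) \<le> cap ?K {u, v}"
    unfolding routable_def by blast
  have g: "\<exists>s t. P = {s, t} \<and> st_flow ?K s t (d P) (g P)" if "P \<in> ?I" for P
    using g_all that by (rule bspec)
  have load: "(\<Sum>P\<in>?I. g P u v + g P v u) \<le> cap ?K {u, v}" if "{u, v} \<in> edges ?K" for u v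
    using load_all that by simp
  have D0: "0 \<le> D v Q" if "v \<in> U" "Q \<in> ?I" for v Q using Dm[OF that(1)] that(2) by (simp add: bmatchings_def)
  have deg: "(\<Sum>t\<in>T - {s}. D v {s, t}) \<le> ext_cap H {v, s}" if "v \<in> U" "s \<in> T" for v s
    using Dm[OF that(1)] that(2) unfolding bmatchings_def sum_pairs_at[OF finite_T that(2), symmetric] by blast
  \<comment> \<open>A missing edge has extended capacity 0, so the degree bound keeps every detour
    away from it.\<close>
  have Dnone: "D v {s, t} = 0" if v: "v \<in> U" and st: "{s, t} \<in> ?I" and ne: "{v, s} \<notin> edges H" for v s t
  proof -
    have *: "s \<in> T" "t \<in> T - {s}" using st by auto
    have "D v {s, t} \<le> (\<Sum>t\<in>T - {s}. D v {s, t})"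
      by (rule member_le_sum[OF *(2)]) (use D0[OF v] * finite_T in \<open>auto\<close>)
    also have "\<dots> \<le> 0" using deg[OF v *(1)] ne by (simp add: ext_cap_def)
    finally show ?thesis using D0[OF v st] by simp
  qed
  have a0: "0 \<le> a Q" if "Q \<in> ?I" for Q
    unfolding a_def using D0 that by (intro add_nonneg_nonneg ext_cap_nonneg sum_nonneg)
  have g0: "0 \<le> g P u v" if "P \<in> ?I" for P u v using g[OF that] by (metis st_flowD(1))
  have ge: "g P u v = 0" if "P \<in> ?I" "{u, v} \<notin> ?I" for P u v
  proof -
    have "{u, v} \<notin> edges ?K" using that(2) by (simp add: terminal_clique_def)
    then show ?thesis using g[OF that(1)] by (metis st_flowD(2))
  qed
  have loop: "g P x x = 0" if "P \<in> ?I" for P x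
    by (rule ge[OF that]) (simp add: nsets_def)
  have load': "(\<Sum>P\<in>?I. g P u v + g P v u) \<le> a {u, v}" if "{u, v} \<in> ?I" for u v
    using load[of u v] that by (simp add: terminal_clique_def)
  \<comment> \<open>A pair with \<open>a\<close> equal to 0 carries no flow, so the shares
    \<open>rv\<close> and \<open>r0\<close>, which are 0 there by division, lose nothing.\<close>
  have zero: "g P u v = 0" if P: "P \<in> ?I" and uv: "{u, v} \<in> ?I" and a: "a {u, v} = 0" for P u v
  proof -
    have "g P u v + g P v u \<le> (\<Sum>P\<in>?I. g P u v + g P v u)"
      using g0 finite_pairs P by (intro member_le_sum) auto
    also have "\<dots> \<le> 0" using load'[OF uv] a by simp
    finally show ?thesis using g0[OF P, of u v] g0[OF P, of v u] by linarith
  qed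
  define rv where "rv v Q = D v Q / a Q" for v Q
  define r0 where "r0 Q = ext_cap H Q / a Q" for Q
  have split: "g P s t * r0 {s, t} + (\<Sum>v\<in>U. g P s t * rv v {s, t}) = g P s t" if P: "P \<in> ?I" for P s t
  proof (cases "g P s t = 0")
    case False
    then have "{s, t} \<in> ?I" using ge[OF P] by blast
    then have "a {s, t} \<noteq> 0" using False zero[OF P] by blast
    moreover have "r0 {s, t} + (\<Sum>v\<in>U. rv v {s, t}) = a {s, t} / a {s, t}"
      unfolding r0_def rv_def sum_divide_distrib[symmetric] add_divide_distrib[symmetric]
      by (simp only: a_def)
    ultimately have "r0 {s, t} + (\<Sum>v\<in>U. rv v {s, t}) = 1" by simp
    then have "g P s t * (r0 {s, t} + (\<Sum>v\<in>U. rv v {s, t})) = g P s t" by simp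
    then show ?thesis by (simp add: distrib_left sum_distrib_left)
  qed simp
  have r0_nonneg: "0 \<le> g P s t * r0 {s, t}" if P: "P \<in> ?I" for P s t
  proof (cases "{s, t} \<in> ?I")
    case True
    then show ?thesis using g0[OF P] a0[OF True] ext_cap_nonneg by (simp add: r0_def)
  qed (use ge[OF P] in simp)
  have rv_nonneg: "0 \<le> g P s t * rv v {s, t}" if P: "P \<in> ?I" and v: "v \<in> U" for P s t v
  proof (cases "{s, t} \<in> ?I")
    case True
    then show ?thesis using g0[OF P] a0[OF True] D0[OF v True] by (simp add: rv_def)
  qed (use ge[OF P] in simp)
  have rv_none: "g P s t * rv v {s, t} = 0" "g P t s * rv v {t, s} = 0"
    if P: "P \<in> ?I" and v: "v \<in> U" and ne: "{v, s} \<notin> edges H" for P s t v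
  proof -
    have *: "rv v {s, t} = 0" if "{s, t} \<in> ?I" using Dnone[OF v that ne] by (simp add: rv_def)
    then show "g P s t * rv v {s, t} = 0" using ge[OF P, of s t] by fastforce
    show "g P t s * rv v {t, s} = 0" using * ge[OF P, of t s] by (metis insert_commute mult_eq_0_iff)
  qed
  define f where "f P x y =
     (if x \<in> T \<and> y \<in> T then g P x y * r0 {x, y}
      else if x \<in> T \<and> y \<in> U then \<Sum>t\<in>T. g P x t * rv y {x, t}
      else if x \<in> U \<and> y \<in> T then \<Sum>s\<in>T. g P s y * rv x {s, y}
      else 0)" for P x y
  have disj: "x \<in> U \<Longrightarrow> x \<notin> T" for x using verts(2) by blast
  have f_out: "(\<Sum>u\<in>verts H. f P x u) = (\<Sum>u\<in>T. g P x u)" if P: "P \<in> ?I" and x: "x \<in> T" for P x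
  proof -
    have "(\<Sum>u\<in>verts H. f P x u) = (\<Sum>t\<in>T. g P x t * r0 {x, t}) + (\<Sum>v\<in>U. \<Sum>t\<in>T. g P x t * rv v {x, t})"
      unfolding sum_verts using x disj by (intro arg_cong2[of _ _ _ _ "(+)"] sum.cong) (auto simp: f_def)
    also have "\<dots> = (\<Sum>t\<in>T. g P x t * r0 {x, t} + (\<Sum>v\<in>U. g P x t * rv v {x, t}))"
      unfolding sum.distrib by (subst (2) sum.swap) simp
    finally show ?thesis using split[OF P] by simp
  qed
  have f_in: "(\<Sum>u\<in>verts H. f P u x) = (\<Sum>u\<in>T. g P u x)" if P: "P \<in> ?I" and x: "x \<in> T" for P x
  proof -
    have "(\<Sum>u\<in>verts H. f P u x) = (\<Sum>t\<in>T. g P t x * r0 {t, x}) + (\<Sum>v\<in>U. \<Sum>t\<in>T. g P t x * rv v {t, x})"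
      unfolding sum_verts using x disj by (intro arg_cong2[of _ _ _ _ "(+)"] sum.cong) (auto simp: f_def)
    also have "\<dots> = (\<Sum>t\<in>T. g P t x * r0 {t, x} + (\<Sum>v\<in>U. g P t x * rv v {t, x}))"
      unfolding sum.distrib by (subst (2) sum.swap) simp
    finally show ?thesis using split[OF P] by simp
  qed
  \<comment> \<open>An exchange of summation: either side counts all detours through
    \<open>v\<close>.\<close>
  have f_bal: "(\<Sum>u\<in>verts H. f P v u) = (\<Sum>u\<in>verts H. f P u v)" if v: "v \<in> U" for P v
  proof -
    have "(\<Sum>u\<in>verts H. f P v u) = (\<Sum>y\<in>T. \<Sum>s\<in>T. g P s y * rv v {s, y})"
      unfolding sum_verts using v disj by (simp add: f_def)
    also have "\<dots> = (\<Sum>s\<in>T. \<Sum>y\<in>T. g P s y * rv v {s, y})" by (rule sum.swap)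
    also have "\<dots> = (\<Sum>u\<in>verts H. f P u v)"
      unfolding sum_verts using v disj by (simp add: f_def)
    finally show ?thesis .
  qed
  have "\<exists>s t. P = {s, t} \<and> st_flow H s t (d P) (f P)" if P: "P \<in> ?I" for P
  proof -
    obtain s t where st: "P = {s, t}" "st_flow ?K s t (d P) (g P)" using g[OF P] by blast
    then have T: "s \<in> T" "t \<in> T" using P by auto
    have "st_flow H s t (d P) (f P)"
      unfolding st_flow_def
    proof (intro conjI allI ballI impI)
      show "0 \<le> f P u v" for u v
        using r0_nonneg[OF P] rv_nonneg[OF P] by (auto simp: f_def intro!: sum_nonneg)
      show "f P u v = 0" if ne: "{u, v} \<notin> edges H" for u v
      proof -
        have ne': "{v, u} \<notin> edges H" using ne by (simp add: insert_commute)
        show ?thesis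
          using rv_none[OF P _ ne] rv_none[OF P _ ne'] ne
          by (auto simp: f_def r0_def ext_cap_def intro!: sum.neutral)
      qed
      show "(\<Sum>u\<in>verts H. f P v u) = (\<Sum>u\<in>verts H. f P u v)" if v: "v \<in> verts H - {s, t}" for v
      proof (cases "v \<in> U")
        case False
        then have "v \<in> T" "v \<in> verts ?K - {s, t}" using v verts by (auto simp: terminal_clique_def)
        then show ?thesis
          using f_out[OF P] f_in[OF P] st_flowD(3)[OF st(2), of v] by (simp add: terminal_clique_def)
      qed (rule f_bal)
      show "(\<Sum>u\<in>verts H. f P s u) - (\<Sum>u\<in>verts H. f P u s) = d P"
        using f_out[OF P T(1)] f_in[OF P T(1)] st_flowD(4)[OF st(2)] by (simp add: terminal_clique_def)
    qed
    then show ?thesis using st(1) by blast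
  qed
  moreover have "(\<Sum>P\<in>?I. f P u v + f P v u) \<le> cap H {u, v}" if e: "{u, v} \<in> edges H" for u v
  proof -
    have TU: "(\<Sum>P\<in>?I. f P x y + f P y x) \<le> ext_cap H {y, x}" if x: "x \<in> T" and y: "y \<in> U" for x y
    proof -
      have "(\<Sum>P\<in>?I. f P x y + f P y x) = (\<Sum>P\<in>?I. \<Sum>t\<in>T. (g P x t + g P t x) * rv y {x, t})"
        using x y disj by (simp add: f_def sum.distrib[symmetric] distrib_right insert_commute)
      also have "\<dots> = (\<Sum>t\<in>T. (\<Sum>P\<in>?I. g P x t + g P t x) * rv y {x, t})"
        unfolding sum_distrib_right by (rule sum.swap)
      also have "\<dots> = (\<Sum>t\<in>T - {x}. (\<Sum>P\<in>?I. g P x t + g P t x) * rv y {x, t})"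
        using loop finite_T x by (subst sum.remove[of T x]) auto
      also have "\<dots> \<le> (\<Sum>t\<in>T - {x}. D y {x, t})"
      proof (rule sum_mono)
        fix t assume "t \<in> T - {x}"
        then have I: "{x, t} \<in> ?I" using x by auto
        have "(\<Sum>P\<in>?I. g P x t + g P t x) * rv y {x, t} \<le> a {x, t} * rv y {x, t}"
          using load'[OF I] D0[OF y I] a0[OF I] by (intro mult_right_mono) (auto simp: rv_def)
        also have "\<dots> \<le> D y {x, t}" using D0[OF y I] by (simp add: rv_def)
        finally show "(\<Sum>P\<in>?I. g P x t + g P t x) * rv y {x, t} \<le> D y {x, t}" .
      qed
      also have "\<dots> \<le> ext_cap H {y, x}" by (rule deg[OF y x])
      finally show ?thesis .
    qed
    have cap: "ext_cap H {u, v} = cap H {u, v}" "ext_cap H {v, u} = cap H {u, v}"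
      using e by (auto simp: ext_cap_def insert_commute)
    have "(u \<in> T \<or> u \<in> U) \<and> (v \<in> T \<or> v \<in> U)" using edge[OF e] verts by auto
    then consider "u \<in> T" "v \<in> T" | "u \<in> T" "v \<in> U" | "u \<in> U" "v \<in> T" | "u \<in> U" "v \<in> U"
      by blast
    then show ?thesis
    proof cases
      case 1
      then have I: "{u, v} \<in> ?I" using edge[OF e] by simp
      have "(\<Sum>P\<in>?I. f P u v + f P v u) = (\<Sum>P\<in>?I. g P u v + g P v u) * r0 {u, v}"
        using 1 by (simp add: f_def sum_distrib_right distrib_right insert_commute)
      also have "\<dots> \<le> a {u, v} * r0 {u, v}"
        using load'[OF I] a0[OF I] ext_cap_nonneg by (intro mult_right_mono) (auto simp: r0_def)
      also have "\<dots> \<le> ext_cap H {u, v}" using ext_cap_nonneg by (simp add: r0_def)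
      finally show ?thesis using cap by simp
    next
      case 2
      then show ?thesis using TU[of u v] cap by simp
    next
      case 3
      then show ?thesis using TU[of v u] cap by (simp add: add.commute)
    next
      case 4
      then show ?thesis using disj cap ext_cap_nonneg[of "{u, v}"] by (simp add: f_def)
    qed
  qed
  ultimately show ?thesis unfolding routable_def by blast
qed

definition star_sum :: "('v \<Rightarrow> real) \<Rightarrow> ('v set \<Rightarrow> real) set" where
  "star_sum = bmatching_sum (nsets T 2) T U (\<lambda>v s. ext_cap H {v, s})"

end

lemma routable_clique_scale:
  assumes T: "finite T" and r: "0 \<le> r" and le: "\<And>Q. Q \<in> nsets T 2 \<Longrightarrow> r * a Q \<le> a' Q"
    and d: "routable (terminal_clique T a) T d"
  shows "routable (terminal_clique T a') T (\<lambda>P. r * d P)"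
proof -
  let ?I = "nsets T 2"
  obtain g where g: "\<forall>P\<in>?I. \<exists>s t. P = {s, t} \<and> st_flow (terminal_clique T a) s t (d P) (g P)"
    and load: "\<forall>u v. {u, v} \<in> ?I \<longrightarrow> (\<Sum>P\<in>?I. g P u v + g P v u) \<le> a {u, v}"
    using d unfolding routable_def by (auto simp: terminal_clique_def)
  have "st_flow (terminal_clique T a') s t (r * x) (\<lambda>u v. r * h u v)"
    if "st_flow (terminal_clique T a) s t x h" for s t x h
    using that r by (auto simp: st_flow_def terminal_clique_def simp flip: sum_distrib_left right_diff_distrib)
  then have "\<forall>P\<in>?I. \<exists>s t. P = {s, t} \<and> st_flow (terminal_clique T a') s t (r * d P) (\<lambda>u v. r * g P u v)"
    using g by meson
  moreover have "(\<Sum>P\<in>?I. r * g P u v + r * g P v u) \<le> a' {u, v}" if uv: "{u, v} \<in> ?I" for u v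
  proof -
    have "(\<Sum>P\<in>?I. r * g P u v + r * g P v u) = r * (\<Sum>P\<in>?I. g P u v + g P v u)"
      by (simp add: sum_distrib_left distrib_left)
    also have "\<dots> \<le> r * a {u, v}" using load uv r by (intro mult_left_mono) auto
    also have "\<dots> \<le> a' {u, v}" by (rule le[OF uv])
    finally show ?thesis .
  qed
  ultimately show ?thesis
    unfolding routable_def by (intro exI[of _ "\<lambda>P u v. r * g P u v"]) (auto simp: terminal_clique_def)
qed

context terminals
begin

lemma routable_iff:
  assumes "quasi_bipartite H T"
  shows "routable H T d \<longleftrightarrow>
    (\<exists>x\<in>star_sum (\<lambda>_. 1). routable (terminal_clique T (\<lambda>Q. ext_cap H Q + x Q)) T d)"
proof
  assume "routable H T d"
  then obtain D where D: "\<forall>v\<in>U. D v \<in> bmatchings (nsets T 2) T (\<lambda>s. ext_cap H {v, s})"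
    and r: "routable (terminal_clique T (\<lambda>Q. ext_cap H Q + (\<Sum>v\<in>U. D v Q))) T d"
    using routable_clique_of_routable[OF assms] by blast
  have "(\<lambda>Q. \<Sum>v\<in>U. D v Q) \<in> star_sum (\<lambda>_. 1)"
    unfolding star_sum_def bmatching_sum_def using D
    by (auto simp: bmatchings_def intro!: sum_nonneg exI[of _ D])
  then show "\<exists>x\<in>star_sum (\<lambda>_. 1). routable (terminal_clique T (\<lambda>Q. ext_cap H Q + x Q)) T d"
    using r by (intro bexI[of _ "\<lambda>Q. \<Sum>v\<in>U. D v Q"])
next
  assume "\<exists>x\<in>star_sum (\<lambda>_. 1). routable (terminal_clique T (\<lambda>Q. ext_cap H Q + x Q)) T d"
  then obtain x where x: "x \<in> star_sum (\<lambda>_. 1)"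
    and r: "routable (terminal_clique T (\<lambda>Q. ext_cap H Q + x Q)) T d" by blast
  obtain D where D: "\<forall>v\<in>U. D v \<in> bmatchings (nsets T 2) T (\<lambda>s. ext_cap H {v, s})"
    and xD: "\<forall>Q\<in>nsets T 2. x Q \<le> (\<Sum>v\<in>U. 1 * D v Q)"
    using x unfolding star_sum_def bmatching_sum_def by blast
  have "routable (terminal_clique T (\<lambda>Q. ext_cap H Q + (\<Sum>v\<in>U. D v Q))) T (\<lambda>P. 1 * d P)"
    by (rule routable_clique_scale[OF finite_T _ _ r]) (use xD in auto)
  then show "routable H T d"
    using routable_of_routable_clique[of D d] D by simp
qed

end

section \<open>The sparsifier\<close>

text \<open>For a positive weight, \<open>w v\<close> times a b-matching polytope is the polytope of
  the scaled capacities, and stars of weight 0 contribute nothing. So a weighted sum is the plain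
  sum of fewer stars.\<close>

lemma bmatching_sum_weights:
  assumes U: "finite U" and w: "\<And>v. v \<in> U \<Longrightarrow> 0 \<le> w v"
    and b: "\<And>v s. v \<in> U \<Longrightarrow> s \<in> T \<Longrightarrow> 0 \<le> b v s"
    and b': "\<And>v s. v \<in> U \<Longrightarrow> 0 < w v \<Longrightarrow> s \<in> T \<Longrightarrow> b' v s = w v * b v s"
  shows "bmatching_sum I T U b w = bmatching_sum I T {v\<in>U. 0 < w v} b' (\<lambda>_. 1)"
proof -
  let ?U = "{v\<in>U. 0 < w v}"
  have drop: "(\<Sum>v\<in>U. w v * D v Q) = (\<Sum>v\<in>?U. w v * D v Q)" for D :: "'a \<Rightarrow> 'b set \<Rightarrow> real" and Q
    using U w by (intro sum.mono_neutral_right) (auto simp: less_le)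
  have "(\<exists>D. (\<forall>v\<in>U. D v \<in> bmatchings I T (b v)) \<and> (\<forall>Q\<in>I. x Q \<le> (\<Sum>v\<in>U. w v * D v Q))) \<longleftrightarrow>
    (\<exists>D. (\<forall>v\<in>?U. D v \<in> bmatchings I T (b' v)) \<and> (\<forall>Q\<in>I. x Q \<le> (\<Sum>v\<in>?U. 1 * D v Q)))" for x
  proof (intro iffI; elim exE conjE)
    fix D assume D: "\<forall>v\<in>U. D v \<in> bmatchings I T (b v)" "\<forall>Q\<in>I. x Q \<le> (\<Sum>v\<in>U. w v * D v Q)"
    have "(\<lambda>Q. w v * D v Q) \<in> bmatchings I T (b' v)" if v: "v \<in> ?U" for v
      using D(1) v b' by (auto simp: bmatchings_def mult_left_mono simp flip: sum_distrib_left)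
    then show "\<exists>D. (\<forall>v\<in>?U. D v \<in> bmatchings I T (b' v)) \<and> (\<forall>Q\<in>I. x Q \<le> (\<Sum>v\<in>?U. 1 * D v Q))"
      using D(2) unfolding drop by (intro exI[of _ "\<lambda>v Q. w v * D v Q"]) auto
  next
    fix D assume D: "\<forall>v\<in>?U. D v \<in> bmatchings I T (b' v)" "\<forall>Q\<in>I. x Q \<le> (\<Sum>v\<in>?U. 1 * D v Q)"
    define E where "E v Q = (if 0 < w v then D v Q / w v else 0)" for v Q
    have "E v \<in> bmatchings I T (b v)" if v: "v \<in> U" for v
    proof (cases "0 < w v")
      case True
      then have "D v \<in> bmatchings I T (b' v)" using D(1) v by simp
      then show ?thesis
        using True b'[OF v True]
        by (auto simp: bmatchings_def E_def divide_le_eq mult.commute simp flip: sum_divide_distrib)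
    next
      case False
      then show ?thesis using b[OF v] by (simp add: bmatchings_def E_def)
    qed
    moreover have "(\<Sum>v\<in>?U. 1 * D v Q) = (\<Sum>v\<in>U. w v * E v Q)" for Q
      unfolding drop by (intro sum.cong) (auto simp: E_def)
    ultimately show "\<exists>D. (\<forall>v\<in>U. D v \<in> bmatchings I T (b v)) \<and> (\<forall>Q\<in>I. x Q \<le> (\<Sum>v\<in>U. w v * D v Q))"
      using D(2) by (intro exI[of _ E]) simp
  qed
  then show ?thesis unfolding bmatching_sum_def by simp
qed

lemma flow_sparsifierI:
  assumes G: "terminal_network G T" and G': "terminal_network G' T" and q: "1 \<le> q"
    and fwd: "\<And>d. routable G T d \<Longrightarrow> routable G' T d"
    and bwd: "\<And>d. routable G' T d \<Longrightarrow> routable G T (\<lambda>P. 1 / q * d P)"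
  shows "flow_sparsifier q G T G'"
  unfolding flow_sparsifier_def
proof (intro conjI allI impI q G')
  fix d assume d: "nonzero_demand T d"
  show "max_throughput G T d \<le> max_throughput G' T d"
    unfolding max_throughput_def
    using throughput_set_nonempty[OF G, of d] throughput_set_bdd_above[OF G' d] fwd
    by (intro cSup_subset_mono) auto
  show "max_throughput G' T d \<le> q * max_throughput G T d"
  proof -
    have "l \<le> q * max_throughput G T d" if l: "0 \<le> l" "routable G' T (\<lambda>P. l * d P)" for l
    proof -
      have "routable G T (\<lambda>P. l / q * d P)" using bwd[OF l(2)] by simp
      then have "l / q \<le> max_throughput G T d"
        unfolding max_throughput_def
        using l(1) q by (intro cSup_upper throughput_set_bdd_above[OF G d]) auto
      then show ?thesis using q by (simp add: divide_le_eq mult.commute)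
    qed
    then show ?thesis
      using throughput_set_nonempty[OF G', of d]
      unfolding max_throughput_def[of G'] by (intro cSup_least) auto
  qed
qed

lemma (in terminals) reweighted_sparsifier:
  assumes quasi: "quasi_bipartite H T" and w: "\<And>v. 0 \<le> w v" and q: "1 \<le> q"
    and fwd: "star_sum (\<lambda>_. 1) \<subseteq> star_sum w"
    and bwd: "\<And>x. x \<in> star_sum w \<Longrightarrow> (\<lambda>Q. x Q / q) \<in> star_sum (\<lambda>_. 1)"
  shows "\<exists>G'. flow_sparsifier q H T G' \<and> verts G' = T \<union> {v\<in>U. 0 < w v}"
proof -
  let ?I = "nsets T 2"
  define U' where "U' = {v\<in>U. 0 < w v}"
  \<comment> \<open>Every vertex is joined to all other terminals, if need be with capacity 0; this
    ensures connectedness and leaves \<open>ext_cap\<close> unaffected. For a star edge,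
    \<open>e - T\<close> contains just the centre, so the sum is the weight of that centre.\<close>
  define G' where "G' = \<lparr>verts = T \<union> U', edges = ?I \<union> {{v, t} |v t. v \<in> U' \<and> t \<in> T},
    cap = (\<lambda>e. (if e \<subseteq> T then 1 else \<Sum>v\<in>e - T. w v) * ext_cap H e)\<rparr>"
  have U': "finite U'" "T \<inter> U' = {}" "U' \<subseteq> U" using finite_U verts(2) by (auto simp: U'_def)
  have edges_G': "edges G' \<subseteq> nsets (verts G') 2"
    using U'(2) by (auto simp: G'_def nsets_def card_insert_if)
  have "T \<noteq> {}" using network by (simp add: terminal_network_def)
  then obtain t0 where t0: "t0 \<in> T" by blast
  have hub: "u = t0 \<or> {u, t0} \<in> edges G'" if "u \<in> verts G'" for u
    using that t0 by (auto simp: G'_def)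
  have conn: "(u, v) \<in> {(x, y). {x, y} \<in> edges G'}\<^sup>*" if "u \<in> verts G'" "v \<in> verts G'" for u v
  proof -
    let ?R = "{(x, y). {x, y} \<in> edges G'}"
    have "(u, t0) \<in> ?R\<^sup>*" using hub[OF that(1)] by auto
    moreover have "(t0, v) \<in> ?R\<^sup>*" using hub[OF that(2)] by (auto simp: insert_commute)
    ultimately show ?thesis by (rule rtrancl_trans)
  qed
  have cap0: "0 \<le> cap G' e" for e
    using w ext_cap_nonneg by (simp add: G'_def sum_nonneg)
  have net: "terminal_network G' T"
    unfolding terminal_network_def
    using edges_G' conn cap0 \<open>T \<noteq> {}\<close> U'(1) finite_T by (auto simp: G'_def)
  interpret G': terminals G' T by unfold_locales (rule net)
  have U_G': "G'.U = U'" unfolding G'.U_def using U'(2) by (auto simp: G'_def)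
  have quasi': "quasi_bipartite G' T"
    using U'(2) by (auto simp: quasi_bipartite_def G'_def doubleton_eq_iff)
  have capT: "ext_cap G' Q = ext_cap H Q" if "Q \<in> ?I" for Q
    unfolding ext_cap_def[of G'] using that by (auto simp: G'_def nsets_def)
  have capU: "ext_cap G' {v, s} = w v * ext_cap H {v, s}" if "v \<in> U'" "s \<in> T" for v s
  proof -
    have "v \<notin> T" "{v, s} - T = {v}" using that U'(2) by auto
    moreover have "{v, s} \<in> edges G'" using that by (auto simp: G'_def)
    ultimately show ?thesis unfolding ext_cap_def[of G'] by (simp add: G'_def)
  qed
  have sum_eq: "star_sum w = G'.star_sum (\<lambda>_. 1)"
    unfolding star_sum_def G'.star_sum_def U_G' unfolding U'_def
    by (rule bmatching_sum_weights) (use finite_U w ext_cap_nonneg capU in \<open>auto simp: U'_def\<close>)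
  have "flow_sparsifier q H T G'"
  proof (rule flow_sparsifierI[OF network net q])
    fix d assume "routable H T d"
    then obtain x where x: "x \<in> star_sum (\<lambda>_. 1)"
      "routable (terminal_clique T (\<lambda>Q. ext_cap H Q + x Q)) T d"
      unfolding routable_iff[OF quasi] by blast
    have "routable (terminal_clique T (\<lambda>Q. ext_cap G' Q + x Q)) T (\<lambda>P. 1 * d P)"
      by (rule routable_clique_scale[OF finite_T _ _ x(2)]) (use capT in auto)
    moreover have "x \<in> G'.star_sum (\<lambda>_. 1)" using x(1) fwd sum_eq by blast
    ultimately show "routable G' T d" unfolding G'.routable_iff[OF quasi'] by auto
  next
    fix d assume "routable G' T d"
    then obtain x where x: "x \<in> star_sum w"
      "routable (terminal_clique T (\<lambda>Q. ext_cap G' Q + x Q)) T d"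
      unfolding G'.routable_iff[OF quasi'] sum_eq by blast
    have "routable (terminal_clique T (\<lambda>Q. ext_cap H Q + x Q / q)) T (\<lambda>P. 1 / q * d P)"
    proof (rule routable_clique_scale[OF finite_T _ _ x(2)])
      fix Q assume Q: "Q \<in> ?I"
      have "1 / q * ext_cap H Q \<le> 1 * ext_cap H Q"
        using q ext_cap_nonneg by (intro mult_right_mono) auto
      then show "1 / q * (ext_cap G' Q + x Q) \<le> ext_cap H Q + x Q / q"
        using capT[OF Q] by (simp add: add_divide_distrib)
    qed (use q in simp)
    then show "routable H T (\<lambda>P. 1 / q * d P)"
      unfolding routable_iff[OF quasi] using bwd[OF x(1)] by (intro bexI[of _ "\<lambda>Q. x Q / q"])
  qed
  moreover have "verts G' = T \<union> U'" by (simp add: G'_def)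
  ultimately show ?thesis unfolding U'_def by blast
qed

text \<open>Without a pair of terminals no demand is nonzero, so the bounds are vacuous. The
  sampling argument starts from at least one pair.\<close>

lemma single_terminal_sparsifier:
  assumes "terminal_network G {a}" "1 \<le> q"
  shows "flow_sparsifier q G {a} \<lparr>verts = {a}, edges = {}, cap = (\<lambda>_. 0)\<rparr>"
proof -
  have "nsets {a} 2 = {}" by (auto simp: nsets_def card_2_iff)
  then show ?thesis
    using assms by (simp add: flow_sparsifier_def nonzero_demand_def terminal_network_def)
qed

text \<open>The crude bound \<open>m + 1 \<le> exp m\<close> in place of a logarithm is affordable: with
  \<open>\<kappa> = card I < k\<^sup>2\<close>, about \<open>\<kappa>\<^sup>3 / \<epsilon>\<^sup>3\<close> samples suffice, so no logarithmic factor is needed.\<close>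

lemma sample_size:
  fixes \<kappa> :: nat and \<epsilon> :: real
  assumes \<kappa>: "1 \<le> \<kappa>" and \<epsilon>: "0 < \<epsilon>" "\<epsilon> \<le> 1"
  shows "\<exists>m N :: nat. 0 < m \<and> real \<kappa> \<le> \<epsilon> / 24 * real m \<and> 0 < N \<and>
    2 * real (m + 1) ^ \<kappa> \<le> exp ((\<epsilon> / 24)\<^sup>2 * real N / (4 * \<kappa>)) \<and> real N \<le> 59905 * real \<kappa> ^ 3 / \<epsilon> ^ 3"
proof -
  define K where "K = real \<kappa>"
  have K: "1 \<le> K" using \<kappa> by (simp add: K_def)
  define m where "m = nat \<lceil>24 * K / \<epsilon>\<rceil>"
  have K\<epsilon>: "1 \<le> K / \<epsilon>" using K \<epsilon> by (simp add: le_divide_eq)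
  have "0 \<le> 24 * K / \<epsilon>" using K \<epsilon> by simp
  then have "real m = of_int \<lceil>24 * K / \<epsilon>\<rceil>" by (simp add: m_def)
  then have m: "24 * K / \<epsilon> \<le> real m" "real m \<le> 24 * K / \<epsilon> + 1" by linarith+
  have m0: "0 < m" using m(1) K\<epsilon> by (cases "m = 0") auto
  have m_le: "real m \<le> 25 * (K / \<epsilon>)" using m(2) K\<epsilon> by simp
  \<comment> \<open>Solves \<open>(\<epsilon> / 24)\<^sup>2 * x / (4 * K) = 1 + K * m\<close>, with
    \<open>2304 = 4 * 24\<^sup>2\<close>; the summand 1 pays for the factor 2 through
    \<open>2 \<le> exp 1\<close>.\<close>
  define x where "x = 2304 * K * (1 + K * m) / \<epsilon>\<^sup>2"
  have x0: "0 < x" using K \<epsilon> by (simp add: x_def add_pos_nonneg)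
  define N where "N = nat \<lceil>x\<rceil>"
  have "real N = of_int \<lceil>x\<rceil>" using x0 by (simp add: N_def)
  then have N: "x \<le> real N" "real N \<le> x + 1" by linarith+
  have N0: "0 < N" using N(1) x0 by (cases "N = 0") auto
  have "2 * real (m + 1) ^ \<kappa> \<le> exp 1 * exp (real m) ^ \<kappa>"
    using exp_ge_add_one_self[of 1] exp_ge_add_one_self[of "real m"]
    by (intro mult_mono power_mono) auto
  also have "\<dots> = exp (1 + K * m)" by (simp add: exp_add exp_of_nat_mult K_def)
  also have "\<dots> \<le> exp ((\<epsilon> / 24)\<^sup>2 * real N / (4 * K))"
  proof -
    have "1 + K * m = (\<epsilon> / 24)\<^sup>2 * x / (4 * K)"
      using K \<epsilon> by (simp add: x_def field_simps power2_eq_square)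
    also have "\<dots> \<le> (\<epsilon> / 24)\<^sup>2 * real N / (4 * K)"
      using N(1) K by (intro divide_right_mono mult_left_mono) auto
    finally show ?thesis by simp
  qed
  finally have big: "2 * real (m + 1) ^ \<kappa> \<le> exp ((\<epsilon> / 24)\<^sup>2 * real N / (4 * \<kappa>))"
    by (simp add: K_def)
  have sq: "1 \<le> K * (K / \<epsilon>)" using mult_mono[OF K K\<epsilon>] K by simp
  have "1 + K * m \<le> 26 * (K * (K / \<epsilon>))"
  proof -
    have "K * m \<le> K * (25 * (K / \<epsilon>))" using m_le K by (intro mult_left_mono) auto
    also have "\<dots> = 25 * (K * (K / \<epsilon>))" by simp
    finally show ?thesis using sq by linarith
  qed
  then have "2304 * K / \<epsilon>\<^sup>2 * (1 + K * m) \<le> 2304 * K / \<epsilon>\<^sup>2 * (26 * (K * (K / \<epsilon>)))"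
    using K by (intro mult_left_mono) auto
  \<comment> \<open>\<open>59904 = 2304 * 26\<close>, where 26 is 24 plus 1 for rounding up
    \<open>m\<close> plus 1 for the factor 2. Rounding up \<open>N\<close> then gives 59905.\<close>
  then have "x \<le> 59904 * (K ^ 3 / \<epsilon> ^ 3)"
    by (simp add: x_def power2_eq_square power3_eq_cube mult_ac)
  moreover have "1 \<le> K ^ 3 / \<epsilon> ^ 3"
    using one_le_power[OF K\<epsilon>, of 3] by (simp add: power_divide)
  ultimately have "real N \<le> 59905 * K ^ 3 / \<epsilon> ^ 3" using N(2) by simp
  moreover have "K \<le> \<epsilon> / 24 * real m" using m(1) \<epsilon> by (simp add: field_simps)
  ultimately show ?thesis using m0 N0 big unfolding K_def by blast
qed

theorem theorem6p2:
  shows "\<exists>C p. \<forall>(G :: 'v network) (T :: 'v set) (k :: nat) (\<epsilon> :: real).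
           terminal_network G T \<and> card T = k \<and> quasi_bipartite G T \<and> 0 < \<epsilon> \<and> \<epsilon> < 1/8 \<longrightarrow>
           (\<exists>G' :: 'v network.
              flow_sparsifier (1 + \<epsilon>) G T G' \<and>
              real (card (verts G')) \<le>
                (C :: real) * (real k ^ 7 / \<epsilon> ^ 3) * ln (real k ^ 7 / \<epsilon> ^ 3) ^ (p :: nat))"
proof (rule exI[of _ "59906 :: real"], rule exI[of _ "0 :: nat"], intro allI impI, elim conjE)
  fix G :: "'v network" and T :: "'v set" and k :: nat and \<epsilon> :: real
  assume net: "terminal_network G T" and k: "card T = k" and quasi: "quasi_bipartite G T"
    and \<epsilon>: "0 < \<epsilon>" "\<epsilon> < 1/8"
  interpret terminals G T by unfold_locales (rule net)
  have "T \<noteq> {}" using net by (simp add: terminal_network_def)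
  then have k1: "1 \<le> k" using k finite_T by (simp add: Suc_le_eq card_gt_0_iff flip: k)
  have \<epsilon>3: "1 \<le> 1 / \<epsilon> ^ 3" using \<epsilon> by (simp add: power_le_one)
  have "\<exists>G'. flow_sparsifier (1 + \<epsilon>) G T G' \<and> real (card (verts G')) \<le> 59906 * (real k ^ 7 / \<epsilon> ^ 3)"
  proof (cases "k = 1")
    case True
    then obtain a where "T = {a}" using k by (auto simp: card_1_singleton_iff)
    then show ?thesis
      using single_terminal_sparsifier[of G a "1 + \<epsilon>"] net \<epsilon> \<epsilon>3 True by force
  next
    case False
    define \<kappa> where "\<kappa> = card (nsets T 2)"
    have \<kappa>_eq: "\<kappa> = k choose 2" unfolding \<kappa>_def k[symmetric] by (rule card_nsets)
    have \<kappa>1: "1 \<le> \<kappa>" using False k1 by (simp add: \<kappa>_eq Suc_le_eq)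
    have \<kappa>_le: "\<kappa> \<le> k ^ 2"
      unfolding \<kappa>_eq choose_two power2_eq_square by (rule order_trans[OF div_le_dividend]) simp
    obtain m N :: nat where mN: "0 < m" "real \<kappa> \<le> \<epsilon> / 24 * real m" "0 < N"
      "2 * real (m + 1) ^ \<kappa> \<le> exp ((\<epsilon> / 24)\<^sup>2 * real N / (4 * \<kappa>))"
      "real N \<le> 59905 * real \<kappa> ^ 3 / \<epsilon> ^ 3"
      using sample_size[OF \<kappa>1, of \<epsilon>] \<epsilon> by auto
    interpret demand_pairs "nsets T 2" T
      by unfold_locales (use finite_T finite_pairs in \<open>auto simp: nsets_def\<close>)
    have "nsets T 2 \<noteq> {}" using \<kappa>1 unfolding \<kappa>_def by (metis card.empty not_one_le_zero)
    then obtain w where w: "\<forall>v. 0 \<le> w v" "card {v\<in>U. 0 < w v} \<le> N"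
      "star_sum (\<lambda>_. 1) \<subseteq> star_sum w"
      "\<forall>x\<in>star_sum w. (\<lambda>Q. x Q / (1 + \<epsilon>)) \<in> star_sum (\<lambda>_. 1)"
      using sparsify_bmatching_sum[OF finite_U _ _ \<epsilon>(1) _ mN(1) _ mN(3), of "\<lambda>v s. ext_cap G {v, s}"]
        ext_cap_nonneg \<epsilon>(2) mN(2,4) unfolding star_sum_def \<kappa>_def by auto
    obtain G' where G': "flow_sparsifier (1 + \<epsilon>) G T G'" "verts G' = T \<union> {v\<in>U. 0 < w v}"
      using reweighted_sparsifier[OF quasi, of w "1 + \<epsilon>"] w \<epsilon>(1) by auto
    have "real (card (verts G')) \<le> real k + real N"
      using card_Un_le[of T "{v\<in>U. 0 < w v}"] w(2) k by (simp add: G'(2))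
    moreover have "real N \<le> 59905 * (real k ^ 7 / \<epsilon> ^ 3)"
    proof -
      have "\<kappa> ^ 3 \<le> k ^ 7"
        using power_mono[OF \<kappa>_le, of 3] power_increasing[of 6 7 k] k1 by (simp flip: power_mult)
      then have "real \<kappa> ^ 3 \<le> real k ^ 7" by (metis of_nat_le_iff of_nat_power)
      then have "real \<kappa> ^ 3 / \<epsilon> ^ 3 \<le> real k ^ 7 / \<epsilon> ^ 3" using \<epsilon> by (intro divide_right_mono) auto
      then show ?thesis using mN(5) by simp
    qed
    \<comment> \<open>The terminals themselves raise the constant from 59905 to 59906.\<close>
    moreover have "real k \<le> real k ^ 7 / \<epsilon> ^ 3"
    proof -
      have "real k * 1 \<le> real k ^ 7 * (1 / \<epsilon> ^ 3)"
        using power_increasing[of 1 7 "real k"] k1 \<epsilon>3 by (intro mult_mono) auto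
      then show ?thesis by simp
    qed
    ultimately have "real (card (verts G')) \<le> 59906 * (real k ^ 7 / \<epsilon> ^ 3)"
      by linarith
    then show ?thesis using G'(1) by blast
  qed
  then show "\<exists>G'. flow_sparsifier (1 + \<epsilon>) G T G' \<and>
      real (card (verts G')) \<le> 59906 * (real k ^ 7 / \<epsilon> ^ 3) * ln (real k ^ 7 / \<epsilon> ^ 3) ^ 0"
    by simp
qed

end
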